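(* Let $1\le p\le\infty$, $\beta\in\mathbb{R}$, $r>1$ and $n\in\mathbb{N}$ satisfy $$n+1\le r\le n^2 .$$ Then for $1\le p<\infty$ $$\mathcal{E}_n(W^r_{\beta,1})_{L_p}=n^{-r}\Big(\frac{\|\cos t\|_{p}}{\pi}\,F^{\frac1{p}}\Big(\frac{p}{2},\frac{p}{2};1;e^{-2r/n}\Big)+O(1)\,r\,n^{-2}e^{-r/n}\Big),$$ and for $p=\infty$ $$\mathcal{E}_n(W^r_{\beta,1})_{L_\infty}=n^{-r}\Big(\frac{1}{\pi(1-e^{-r/n})}+O(1)\,r\,n^{-2}e^{-r/n}\Big),$$ where the quantities $O(1)$ are uniformly bounded with respect to all parameters considered, i.e. bounded in absolute value by an absolute constant independent of $p,\beta,r,n$.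
   Context: $L_p$, $1\le p<\infty$, is the space of $2\pi$-periodic functions $\varphi$ with $\|\varphi\|_p=\big(\int_{-\pi}^{\pi}|\varphi(t)|^p\,dt\big)^{1/p}<\infty$; $L_\infty$ is the space of $2\pi$-periodic measurable essentially bounded functions with $\|\varphi\|_\infty=\operatorname{ess\,sup}_t|\varphi(t)|$. Let $B_1^0=\{\varphi\in L_1:\ \|\varphi\|_1\le 1,\ \int_{-\pi}^{\pi}\varphi(t)\,dt=0\}$. For $r>0$, $\beta\in\mathbb{R}$, the Weyl--Nagy class $W^r_{\beta,1}$ is the set of all $2\pi$-periodic functions $f$ of the form $$f(x)=\frac{a_0}{2}+\frac1\pi\int_{-\pi}^{\pi}\varphi(x-t)B_{r,\beta}(t)\,dt,\quad a_0\in\mathbb{R},\ \varphi\in B_1^0,\qquad B_{r,\beta}(t)=\sum_{k=1}^\infty k^{-r}\cos\Big(kt-\frac{\beta\pi}{2}\Big).$$ For a set $\mathfrak{N}\subset L_s$, $1\le s\le\infty$, put $$\mathcal{E}_n(\mathfrak{N})_{L_s}=\sup_{f\in\mathfrak{N}}\|f(\cdot)-S_{n-1}(f;\cdot)\|_{s},$$ where $S_{n-1}(f;\cdot)$ is the partial Fourier sum of $f$ of order $n-1$ (harmonics $0,1,\dots,n-1$). $F(a,b;c;z)=1+\sum_{k=1}^\infty\frac{(a)_k(b)_k}{(c)_k}\frac{z^k}{k!}$, with $(x)_k=x(x+1)\cdots(x+k-1)$, is the Gauss hypergeometric function; $F^{1/p}(\cdot)$ denotes its value raised to the power $1/p$.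 *)

theory Defs
  imports "HOL-Analysis.Analysis" "HOL-Probability.Essential_Supremum"
begin

text \<open>
  The norms take values in \<^typ>\<open>ereal\<close>, so that suprema of norms are suprema in a
  complete lattice and no finiteness has to be presupposed. The exponent is an \<^typ>\<open>ereal\<close>
  as well, with \<open>\<infinity>\<close> selecting the essential supremum.
\<close>

definition Lp_norm :: "ereal \<Rightarrow> (real \<Rightarrow> real) \<Rightarrow> ereal" where
  "Lp_norm p f =
     (if p = \<infinity> then esssup (lebesgue_on {-pi..pi}) (\<lambda>t. ereal \<bar>f t\<bar>)
      else let I = (\<integral>\<^sup>+ t. ennreal (\<bar>f t\<bar> powr real_of_ereal p) \<partial>lebesgue_on {-pi..pi})
           in if I = \<infinity> then \<infinity> else ereal (enn2real I powr (1 / real_of_ereal p)))"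

definition Lp_space :: "ereal \<Rightarrow> (real \<Rightarrow> real) set" where
  "Lp_space p =
     {\<phi>. (\<forall>t. \<phi> (t + 2 * pi) = \<phi> t) \<and> \<phi> \<in> borel_measurable lebesgue \<and> Lp_norm p \<phi> < \<infinity>}"

definition B01 :: "(real \<Rightarrow> real) set" where
  "B01 = {\<phi> \<in> Lp_space 1. Lp_norm 1 \<phi> \<le> 1 \<and> (\<integral>t. \<phi> t \<partial>lebesgue_on {-pi..pi}) = 0}"

definition weyl_nagy_kernel :: "real \<Rightarrow> real \<Rightarrow> real \<Rightarrow> real" where
  "weyl_nagy_kernel r \<beta> t =
     (\<Sum>k. real (Suc k) powr (- r) * cos (real (Suc k) * t - \<beta> * pi / 2))"

definition weyl_nagy_class :: "real \<Rightarrow> real \<Rightarrow> (real \<Rightarrow> real) set" where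
  "weyl_nagy_class r \<beta> =
     {f. \<exists>a0. \<exists>\<phi>\<in>B01. \<forall>x. f x = a0 / 2 +
          1 / pi * (\<integral>t. \<phi> (x - t) * weyl_nagy_kernel r \<beta> t \<partial>lebesgue_on {-pi..pi})}"

definition fourier_cos_coeff :: "(real \<Rightarrow> real) \<Rightarrow> nat \<Rightarrow> real" where
  "fourier_cos_coeff f k = 1 / pi * (\<integral>t. f t * cos (real k * t) \<partial>lebesgue_on {-pi..pi})"

definition fourier_sin_coeff :: "(real \<Rightarrow> real) \<Rightarrow> nat \<Rightarrow> real" where
  "fourier_sin_coeff f k = 1 / pi * (\<integral>t. f t * sin (real k * t) \<partial>lebesgue_on {-pi..pi})"

definition fourier_sum :: "nat \<Rightarrow> (real \<Rightarrow> real) \<Rightarrow> real \<Rightarrow> real" where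
  "fourier_sum m f x = fourier_cos_coeff f 0 / 2 +
     (\<Sum>k=1..m. fourier_cos_coeff f k * cos (real k * x) + fourier_sin_coeff f k * sin (real k * x))"

text \<open>The subtraction \<^term>\<open>n - 1\<close> is on \<^typ>\<open>nat\<close>; only \<^prop>\<open>n \<ge> 1\<close> is meaningful.\<close>

definition fourier_approx_error :: "nat \<Rightarrow> (real \<Rightarrow> real) set \<Rightarrow> ereal \<Rightarrow> ereal" where
  "fourier_approx_error n N s = (SUP f\<in>N. Lp_norm s (\<lambda>x. f x - fourier_sum (n - 1) f x))"

definition gauss_hypergeo :: "real \<Rightarrow> real \<Rightarrow> real \<Rightarrow> real \<Rightarrow> real" where
  "gauss_hypergeo a b c z =
     (\<Sum>k. pochhammer a k * pochhammer b k / pochhammer c k * (z ^ k / fact k))"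

end

(* The deviation of a function of the class from its partial Fourier sum is (1/pi) (phi * K), where K
   is the tail of the kernel. Up to a factor n^(-r) and an error r n^(-2) q in the supremum norm, with
   q = exp(-r/n), the tail is the geometric kernel P(t) = Re (exp(i(nt - b)) / (1 - q exp(it))),
   b = beta pi/2. Young's inequality gives the upper bound |K|_p / pi. Since shifting P by pi/n nearly
   changes its sign, mean-zero test functions close to half the difference of two point masses at
   distance pi/n attain this bound up to the error term.

   For the norm of P itself: changing the phase b by n s is almost a translation by s, so all phases
   give the same norm up to O(q/n), while the p-th power mean of the norm over all phases equals
   |cos|_p F(p/2, p/2; 1; q^2)^(1/p) exactly, by Fubini and Parseval's identity for the binomial
   series of (1 - z)^(-p/2). *)

theory Submission
  imports Defs
begin

section \<open>Periodic functions and convolutions\<close>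

text \<open>The condition n + 1 \<le> r \<le> n^2 acts at two places. Its lower half gives q \<le>
  1/2 and turns errors of order q/n, the price of translating the geometric kernel, into multiples
  of r n^(-2) q. Both halves control the replacement of (1 + j/n)^(-r) by q^j: for j = 1 the
  exponents differ by at most r/n^2 \<le> 1, so a factor q can be split off at bounded cost, and r
  \<ge> n + 1 makes what remains decay like j^(-4), uniformly in n and r. Uniformity in p comes from
  measuring each error in the supremum norm first; passing to the p-norm costs the factor (2
  pi)^(1/p) \<le> 2 pi. Point masses are not integrable functions, so narrow windows replace them.
  Their width may depend on n and r without harm, since only the modulus of continuity of the tail
  restricts it. For p = infinity no averaging over phases is needed: the geometric kernel is at most
  the sum of the q^j, and it almost reaches this value where all its cosines are nearly 1.\<close>

lemma sums_integral_dominated: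
  fixes f :: "nat \<Rightarrow> 'a \<Rightarrow> 'b::{banach, second_countable_topology}"
  assumes w: "integrable M w" and meas: "\<And>k. f k \<in> borel_measurable M"
    and bound: "\<And>k x. x \<in> space M \<Longrightarrow> norm (f k x) \<le> m k * w x" and m: "summable m"
  shows "(\<lambda>k. integral\<^sup>L M (f k)) sums integral\<^sup>L M (\<lambda>x. \<Sum>k. f k x)"
    and "integrable M (\<lambda>x. \<Sum>k. f k x)"
proof -
  have int: "integrable M (f k)" for k
  proof (rule Bochner_Integration.integrable_bound)
    show "integrable M (\<lambda>x. m k * w x)" using w by simp
    show "AE x in M. norm (f k x) \<le> norm (m k * w x)"
      using bound[of _ k] by (intro AE_I2) fastforce
  qed (rule meas)
  have ae: "AE x in M. summable (\<lambda>k. norm (f k x))"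
  proof (rule AE_I2)
    fix x assume "x \<in> space M"
    then show "summable (\<lambda>k. norm (f k x))"
      by (intro summable_comparison_test'[OF summable_mult2[OF m, of "w x"]]) (simp add: bound)
  qed
  have "norm (\<integral>x. norm (f k x) \<partial>M) \<le> m k * integral\<^sup>L M w" for k
  proof -
    have "(\<integral>x. norm (f k x) \<partial>M) \<le> (\<integral>x. m k * w x \<partial>M)"
      using int w bound by (intro integral_mono) auto
    then show ?thesis by simp
  qed
  then have s: "summable (\<lambda>k. \<integral>x. norm (f k x) \<partial>M)"
    by (intro summable_comparison_test'[OF summable_mult2[OF m]]) auto
  show "(\<lambda>k. integral\<^sup>L M (f k)) sums integral\<^sup>L M (\<lambda>x. \<Sum>k. f k x)"
    by (rule sums_integral[OF int ae s])
  show "integrable M (\<lambda>x. \<Sum>k. f k x)"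
    by (rule integrable_suminf[OF int ae s])
qed

lemma periodic_plus_int:
  fixes g :: "real \<Rightarrow> 'a"
  assumes "\<And>t. g (t + 2 * pi) = g t"
  shows "g (t + 2 * pi * of_int k) = g t"
proof -
  have nat: "g (t + 2 * pi * real m) = g t" for t m
  proof (induction m)
    case (Suc m)
    then show ?case using assms[of "t + 2 * pi * real m"] by (simp add: algebra_simps)
  qed simp
  show ?thesis
  proof (cases "k \<ge> 0")
    case True
    then show ?thesis using nat[of t "nat k"] by simp
  next
    case False
    then have "g (t + 2 * pi * of_int k + 2 * pi * real (nat (- k))) = g t"
      by (simp add: algebra_simps)
    then show ?thesis by (simp only: nat)
  qed
qed

lemma has_integral_periodic:
  fixes g :: "real \<Rightarrow> real"
  assumes g: "\<And>t. g (t + 2 * pi) = g t" and I: "(g has_integral I) {-pi..pi}"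
  shows "(g has_integral I) {a..a + 2 * pi}"
proof -
  have shift: "(g has_integral J) {u + 2 * pi * of_int k..v + 2 * pi * of_int k}"
    if "(g has_integral J) {u..v}" for J u v k
    using has_integral_affinity'[of g J u v 1 "- 2 * pi * of_int k"] that
      periodic_plus_int[of g, OF g, of _ "-k"] by (simp add: algebra_simps)
  \<comment> \<open>The translate of the basic period by 2 pi k starts at some \<open>c\<close> with
    c \<le> a \<le> c + 2 pi. Its part to the left of \<open>a\<close> is then moved to the right
    end by one period.\<close>
  define k where "k = \<lfloor>(a + pi) / (2 * pi)\<rfloor>"
  define c where "c = -pi + 2 * pi * of_int k"
  have "of_int k \<le> (a + pi) / (2 * pi)" "(a + pi) / (2 * pi) \<le> of_int k + 1"
    unfolding k_def by linarith+
  then have ca: "c \<le> a" "a \<le> c + 2 * pi" unfolding c_def by (simp_all add: field_simps)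
  have c: "(g has_integral I) {c..c + 2 * pi}"
    using shift[OF I, of k] unfolding c_def by (simp add: algebra_simps)
  then have "g integrable_on {c..a}" "g integrable_on {a..c + 2 * pi}"
    using ca by (auto intro: integrable_on_subinterval)
  then obtain J1 J2 where J: "(g has_integral J1) {c..a}" "(g has_integral J2) {a..c + 2 * pi}"
    by blast
  then have "I = J1 + J2"
    using has_integral_combine[OF ca J] c has_integral_unique by blast
  moreover have "(g has_integral J1) {c + 2 * pi..a + 2 * pi}"
    using shift[OF J(1), of 1] by simp
  then have "(g has_integral (J2 + J1)) {a..a + 2 * pi}"
    using has_integral_combine[OF _ _ J(2)] ca by auto
  ultimately show ?thesis by (simp add: add.commute)
qed

lemma has_integral_periodic_shift:
  fixes g :: "real \<Rightarrow> real"
  assumes g: "\<And>t. g (t + 2 * pi) = g t" and I: "(g has_integral I) {-pi..pi}"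
  shows "((\<lambda>t. g (t - s)) has_integral I) {-pi..pi}"
proof -
  have "(g has_integral I) {-pi - s..-pi - s + 2 * pi}"
    by (rule has_integral_periodic[of g, OF g I])
  from has_integral_affinity'[of g _ "-pi - s" "-pi - s + 2 * pi" 1 "-s"] this
  show ?thesis by simp
qed

lemma integral_periodic_shift:
  fixes g :: "real \<Rightarrow> real"
  assumes g: "\<And>t. g (t + 2 * pi) = g t" and c: "continuous_on UNIV g"
  shows "integral {-pi..pi} (\<lambda>t. g (t - s)) = integral {-pi..pi} g"
proof -
  have "g integrable_on {-pi..pi}"
    using c by (intro integrable_continuous_real) (auto intro: continuous_on_subset)
  then show ?thesis
    by (intro integral_unique has_integral_periodic_shift g integrable_integral)
qed

lemma has_integral_periodic_reflect:
  fixes g :: "real \<Rightarrow> real"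
  assumes g: "\<And>t. g (t + 2 * pi) = g t" and I: "(g has_integral I) {-pi..pi}"
  shows "((\<lambda>t. g (x - t)) has_integral I) {-pi..pi}"
proof -
  have "((\<lambda>t. g (- t)) has_integral I) {- (x + pi)..- (x - pi)}"
    using has_integral_periodic[of g, OF g I, of "x - pi"]
    by (subst has_integral_reflect_real) (simp add: algebra_simps)
  then have "((\<lambda>t. g (- t)) has_integral I) {- x - pi..- x + pi}" by simp
  then show ?thesis
    using has_integral_affinity'[of "\<lambda>t. g (- t)" I "- x - pi" "- x + pi" 1 "-x"] by simp
qed

lemma absolutely_integrable_mult_continuous:
  fixes \<phi> B :: "real \<Rightarrow> real"
  assumes \<phi>: "\<phi> absolutely_integrable_on {a..b}" and B: "continuous_on {a..b} B"
  shows "(\<lambda>u. \<phi> u * B u) absolutely_integrable_on {a..b}"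
proof -
  have "bounded (B ` {a..b})"
    using B compact_continuous_image compact_imp_bounded by blast
  then have "(\<lambda>u. B u * \<phi> u) absolutely_integrable_on {a..b}"
    using continuous_imp_measurable_on_sets_lebesgue[OF B] \<phi>
    by (intro absolutely_integrable_bounded_measurable_product_real) auto
  then show ?thesis by (simp add: mult.commute)
qed

text \<open>The class has the translation on \<open>\<phi>\<close>. The estimates need it on the
  kernel, which is continuous, with \<open>\<phi>\<close> as a fixed weight that is merely
  integrable.\<close>

lemma convolution_commute:
  fixes \<phi> B :: "real \<Rightarrow> real"
  assumes \<phi>: "\<phi> absolutely_integrable_on {-pi..pi}" "\<And>t. \<phi> (t + 2 * pi) = \<phi> t"
    and B: "continuous_on UNIV B" "\<And>t. B (t + 2 * pi) = B t"
  shows "(\<integral>t. \<phi> (x - t) * B t \<partial>lebesgue_on {-pi..pi}) =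
         (\<integral>u. \<phi> u * B (x - u) \<partial>lebesgue_on {-pi..pi})"
proof -
  define H where "H = (\<lambda>u. \<phi> u * B (x - u))"
  have per: "H (t + 2 * pi) = H t" for t
    using \<phi>(2)[of t] B(2)[of "x - t - 2 * pi"] unfolding H_def by (simp add: algebra_simps)
  have H: "H absolutely_integrable_on {-pi..pi}"
    unfolding H_def
    by (intro absolutely_integrable_mult_continuous \<phi> continuous_on_compose2[OF B(1)]
        continuous_intros) auto
  have Hx: "H (x - t) = \<phi> (x - t) * B t" for t by (simp add: H_def)
  have i1: "((\<lambda>t. H (x - t)) has_integral (integral {-pi..pi} H)) {-pi..pi}"
    using H per absolutely_integrable_on_def[of _ H] by (intro has_integral_periodic_reflect) auto
  have i2: "((\<lambda>t. \<bar>H (x - t)\<bar>) has_integral (integral {-pi..pi} (\<lambda>t. \<bar>H t\<bar>))) {-pi..pi}"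
    using H per absolutely_integrable_on_def[of _ H]
    by (intro has_integral_periodic_reflect[of "\<lambda>t. \<bar>H t\<bar>"]) auto
  have "(\<lambda>t. H (x - t)) absolutely_integrable_on {-pi..pi}"
    using i1 i2 unfolding absolutely_integrable_on_def by auto
  then have int: "integrable (lebesgue_on {-pi..pi}) (\<lambda>t. H (x - t))"
    by (rule absolutely_integrable_imp_integrable) simp
  have "(\<integral>t. H (x - t) \<partial>lebesgue_on {-pi..pi}) = integral {-pi..pi} H"
    using lebesgue_integral_eq_integral[OF int] i1 by (simp add: integral_unique)
  also have "\<dots> = (\<integral>u. H u \<partial>lebesgue_on {-pi..pi})"
    using lebesgue_integral_eq_integral[OF absolutely_integrable_imp_integrable[OF H]] by simp
  finally show ?thesis unfolding Hx by (simp add: H_def)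
qed

section \<open>Fourier sums of absolutely convergent trigonometric series\<close>

abbreviation period_measure :: "real measure" where
  "period_measure \<equiv> lebesgue_on {-pi..pi}"

lemma
  fixes f :: "real \<Rightarrow> real"
  assumes "continuous_on {-pi..pi} f"
  shows period_integrable_continuous: "integrable period_measure f"
    and period_integral_continuous: "(\<integral>t. f t \<partial>period_measure) = integral {-pi..pi} f"
    and period_measurable_continuous: "f \<in> borel_measurable period_measure"
proof -
  show i: "integrable period_measure f"
    by (rule continuous_imp_integrable_real[OF assms])
  then show "(\<integral>t. f t \<partial>period_measure) = integral {-pi..pi} f"
    by (rule lebesgue_integral_eq_integral) simp
  show "f \<in> borel_measurable period_measure"
    using i by (rule borel_measurable_integrable)
qed

text \<open>An integer frequency and a free phase let one formula serve all orthogonality relations: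
  the difference k - m may be negative or zero, and the phase -pi/2 turns the cosine into a
  sine.\<close>

lemma integral_cos_phase:
  "(\<integral>t. cos (of_int k * t + c) \<partial>period_measure) = (if k = 0 then 2 * pi * cos c else 0)"
proof (cases "k = 0")
  case False
  have "((\<lambda>t. cos (of_int k * t + c)) has_integral
      (sin (of_int k * pi + c) / of_int k - sin (of_int k * (- pi) + c) / of_int k)) {-pi..pi}"
    using False
    by (intro fundamental_theorem_of_calculus)
       (auto intro!: derivative_eq_intros simp flip: has_real_derivative_iff_has_vector_derivative)
  moreover have "sin (of_int k * pi + c) = sin (of_int k * (- pi) + c)"
    using sin_npi_int[of k] by (simp add: sin_add sin_diff mult.commute)
  ultimately show ?thesis
    using False by (subst period_integral_continuous) (auto intro!: continuous_intros simp: integral_unique)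
qed (simp add: measure_restrict_space)

lemma integral_trig_orthogonal:
  fixes k m :: nat
  shows "(\<integral>t. cos (real k * t) * cos (real m * t) \<partial>period_measure) =
           (if k = m then if k = 0 then 2 * pi else pi else 0)"
    and "(\<integral>t. sin (real k * t) * sin (real m * t) \<partial>period_measure) =
           (if k = m \<and> k \<noteq> 0 then pi else 0)"
    and "(\<integral>t. sin (real k * t) * cos (real m * t) \<partial>period_measure) = 0"
proof -
  let ?c = "\<lambda>j c t. cos (of_int j * t + c)"
  have int: "integrable period_measure (?c j c)" for j :: int and c
    by (intro period_integrable_continuous continuous_intros)
  have lin: "(\<integral>t. (x * f t + y * g t) / 2 \<partial>period_measure) =
      (x * (\<integral>t. f t \<partial>period_measure) + y * (\<integral>t. g t \<partial>period_measure)) / 2"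
    if "integrable period_measure f" "integrable period_measure g" for x y :: real and f g
    using that by simp
  have split: "(\<integral>t. (x * ?c (int k - int m) c t + y * ?c (int k + int m) c t) / 2 \<partial>period_measure) =
    (x * (if k = m then 2 * pi * cos c else 0) + y * (if k = 0 \<and> m = 0 then 2 * pi * cos c else 0)) / 2"
    for x y c
    by (simp only: lin[OF int int] integral_cos_phase) auto
  have "cos (real k * t) * cos (real m * t) =
      (1 * ?c (int k - int m) 0 t + 1 * ?c (int k + int m) 0 t) / 2" for t
    by (simp add: cos_times_cos algebra_simps)
  then show "(\<integral>t. cos (real k * t) * cos (real m * t) \<partial>period_measure) =
           (if k = m then if k = 0 then 2 * pi else pi else 0)"
    by (simp only: split) auto
  have "sin (real k * t) * sin (real m * t) =
      (1 * ?c (int k - int m) 0 t + (-1) * ?c (int k + int m) 0 t) / 2" for t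
    by (simp add: sin_times_sin algebra_simps)
  then show "(\<integral>t. sin (real k * t) * sin (real m * t) \<partial>period_measure) =
           (if k = m \<and> k \<noteq> 0 then pi else 0)"
    by (simp only: split) auto
  have sc: "?c j (- (pi / 2)) t = sin (of_int j * t)" for j :: int and t
    using cos_diff[of "of_int j * t" "pi / 2"] by simp
  have "sin (real k * t) * cos (real m * t) =
      (1 * ?c (int k - int m) (- (pi / 2)) t + 1 * ?c (int k + int m) (- (pi / 2)) t) / 2" for t
    unfolding sc by (simp add: sin_times_cos distrib_right left_diff_distrib)
  then show "(\<integral>t. sin (real k * t) * cos (real m * t) \<partial>period_measure) = 0"
    by (simp only: split) auto
qed

text \<open>Multiplied by a harmonic, an absolutely convergent series can be integrated term by
  term, so it is its own Fourier series. Position \<open>j\<close> carries the harmonic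
  \<open>Suc j\<close>; hence the harmonics 1 to m are the positions below m.\<close>

lemma fourier_sum_trigonometric_series:
  fixes A B :: "nat \<Rightarrow> real" and a :: real
  defines "T \<equiv> \<lambda>j x. A j * cos (real (Suc j) * x) + B j * sin (real (Suc j) * x)"
  assumes A: "summable (\<lambda>j. \<bar>A j\<bar>)" and B: "summable (\<lambda>j. \<bar>B j\<bar>)"
    and f: "\<And>x. f x = a + (\<Sum>j. T j x)"
  shows "fourier_sum m f x = a + (\<Sum>j<m. T j x)" and "summable (\<lambda>j. T j x)"
proof -
  have AB: "summable (\<lambda>j. \<bar>A j\<bar> + \<bar>B j\<bar>)" by (rule summable_add[OF A B])
  have Tb: "\<bar>T j x\<bar> \<le> \<bar>A j\<bar> + \<bar>B j\<bar>" for j x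
  proof -
    have "\<bar>A j\<bar> * \<bar>cos (real (Suc j) * x)\<bar> \<le> \<bar>A j\<bar> * 1"
      "\<bar>B j\<bar> * \<bar>sin (real (Suc j) * x)\<bar> \<le> \<bar>B j\<bar> * 1"
      by (intro mult_left_mono; simp)+
    then show ?thesis unfolding T_def
      by (intro order.trans[OF abs_triangle_ineq]) (simp add: abs_mult)
  qed
  show sT: "summable (\<lambda>j. T j x)" for x
    using AB Tb by (intro summable_comparison_test'[OF AB]) auto
  have Tc: "continuous_on S (T j)" for S j
    unfolding T_def by (intro continuous_intros)
  have coeff: "(\<integral>t. f t * w t \<partial>period_measure) =
      a * (\<integral>t. w t \<partial>period_measure) + (\<Sum>j. \<integral>t. T j t * w t \<partial>period_measure)"
    if w: "continuous_on {-pi..pi} w" and w1: "\<And>t. \<bar>w t\<bar> \<le> 1" for w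
  proof -
    have b: "norm (T j t * w t) \<le> (\<bar>A j\<bar> + \<bar>B j\<bar>) * 1" for j t
      unfolding real_norm_def abs_mult by (intro mult_mono Tb w1) auto
    note * = sums_integral_dominated[where M=period_measure and w="\<lambda>_. 1" and
        f="\<lambda>j t. T j t * w t", OF _ _ b AB]
    have i: "integrable period_measure (\<lambda>t. a * w t)"
      by (intro period_integrable_continuous continuous_intros w)
    have m: "(\<lambda>t. T j t * w t) \<in> borel_measurable period_measure" for j
      by (intro period_measurable_continuous continuous_intros w Tc)
    have o: "integrable period_measure (\<lambda>_. 1::real)"
      by (intro period_integrable_continuous continuous_intros)
    have "(\<integral>t. f t * w t \<partial>period_measure) =
      (\<integral>t. a * w t + (\<Sum>j. T j t * w t) \<partial>period_measure)"
      using suminf_mult2[OF sT] by (simp add: f distrib_right)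
    also have "\<dots> = a * (\<integral>t. w t \<partial>period_measure) + (\<Sum>j. \<integral>t. T j t * w t \<partial>period_measure)"
      using *[OF o m] i by (simp add: sums_iff)
    finally show ?thesis .
  qed
  have Tcos: "(\<integral>t. T j t * cos (real k * t) \<partial>period_measure) = (if Suc j = k then pi * A j else 0)" for j k
  proof -
    have "(\<integral>t. T j t * cos (real k * t) \<partial>period_measure) =
      (\<integral>t. A j * (cos (real (Suc j) * t) * cos (real k * t)) +
            B j * (sin (real (Suc j) * t) * cos (real k * t)) \<partial>period_measure)"
      unfolding T_def by (simp only: distrib_right mult.assoc)
    also have "\<dots> = A j * (\<integral>t. cos (real (Suc j) * t) * cos (real k * t) \<partial>period_measure) +
        B j * (\<integral>t. sin (real (Suc j) * t) * cos (real k * t) \<partial>period_measure)"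
      by (subst Bochner_Integration.integral_add)
         (auto intro!: period_integrable_continuous continuous_intros simp del: of_nat_Suc)
    finally show ?thesis by (simp only: integral_trig_orthogonal) auto
  qed
  have Tsin: "(\<integral>t. T j t * sin (real k * t) \<partial>period_measure) = (if Suc j = k then pi * B j else 0)" for j k
  proof -
    have "(\<integral>t. T j t * sin (real k * t) \<partial>period_measure) =
      (\<integral>t. A j * (sin (real k * t) * cos (real (Suc j) * t)) +
            B j * (sin (real (Suc j) * t) * sin (real k * t)) \<partial>period_measure)"
      unfolding T_def by (simp add: algebra_simps del: of_nat_Suc)
    also have "\<dots> = A j * (\<integral>t. sin (real k * t) * cos (real (Suc j) * t) \<partial>period_measure) +
        B j * (\<integral>t. sin (real (Suc j) * t) * sin (real k * t) \<partial>period_measure)"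
      by (subst Bochner_Integration.integral_add)
         (auto intro!: period_integrable_continuous continuous_intros simp del: of_nat_Suc)
    finally show ?thesis by (simp only: integral_trig_orthogonal) auto
  qed
  have ic: "(\<integral>t. cos (real k * t) \<partial>period_measure) = (if k = 0 then 2 * pi else 0)" for k
    using integral_cos_phase[of "int k" 0] by simp
  have isn: "(\<integral>t. sin (real k * t) \<partial>period_measure) = 0" for k
    using integral_trig_orthogonal(3)[of k 0] by simp
  have single: "(\<Sum>j. if j = i then F j else 0) = F i" for F :: "nat \<Rightarrow> real" and i
    using sums_single[of i F] by (simp add: sums_iff)
  have c0: "fourier_cos_coeff f 0 = 2 * a"
    unfolding fourier_cos_coeff_def
    by (subst coeff) (auto intro!: continuous_intros simp: Tcos[where k=0, simplified] ic[where k=0, simplified])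
  have cS: "fourier_cos_coeff f (Suc i) = A i" for i
    unfolding fourier_cos_coeff_def
    by (subst coeff) (auto intro!: continuous_intros simp: Tcos ic single simp del: of_nat_Suc)
  have sS: "fourier_sin_coeff f (Suc i) = B i" for i
    unfolding fourier_sin_coeff_def
    by (subst coeff) (auto intro!: continuous_intros simp: Tsin isn single simp del: of_nat_Suc)
  have "(\<Sum>k=1..m. fourier_cos_coeff f k * cos (real k * x) + fourier_sin_coeff f k * sin (real k * x)) =
      (\<Sum>j<m. T j x)"
    by (simp add: sum.atLeast1_atMost_eq T_def cS sS del: of_nat_Suc)
  then show "fourier_sum m f x = a + (\<Sum>j<m. T j x)"
    unfolding fourier_sum_def c0 by simp
qed

section \<open>The remainder as a convolution\<close>

text \<open>One family for all series that occur: the Weyl-Nagy kernel (n = 1), its tail, the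
  geometric kernel, and, for n = 0 with the phases 0 and pi/2, the real and imaginary part of a
  power series with real coefficients on a circle.\<close>

definition trig_kernel :: "(nat \<Rightarrow> real) \<Rightarrow> nat \<Rightarrow> real \<Rightarrow> real \<Rightarrow> real" where
  "trig_kernel c n b t = (\<Sum>j. c j * cos (real (j + n) * t - b))"

lemma trig_kernel_term_le: "\<bar>c * cos x\<bar> \<le> \<bar>c::real\<bar>"
  using mult_left_mono[OF abs_cos_le_one[of x] abs_ge_zero[of c]] by (simp add: abs_mult)

lemma summable_trig_kernel:
  assumes "summable (\<lambda>j. \<bar>c j\<bar>)"
  shows "summable (\<lambda>j. c j * cos (real (j + n) * t - b))"
  by (intro summable_comparison_test'[OF assms]) (simp add: trig_kernel_term_le del: of_nat_add)

lemma continuous_trig_kernel: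
  assumes c: "summable (\<lambda>j. \<bar>c j\<bar>)"
  shows "continuous_on S (trig_kernel c n b)"
proof -
  have "uniform_limit UNIV (\<lambda>N t. \<Sum>j<N. c j * cos (real (j + n) * t - b))
      (\<lambda>t. \<Sum>j. c j * cos (real (j + n) * t - b)) sequentially"
    by (intro Weierstrass_m_test[OF _ c]) (simp add: trig_kernel_term_le del: of_nat_add)
  then have "continuous_on UNIV (\<lambda>t. \<Sum>j. c j * cos (real (j + n) * t - b))"
    by (rule uniform_limit_theorem[rotated]) (auto intro!: always_eventually continuous_intros)
  then show ?thesis
    unfolding trig_kernel_def[abs_def] by (rule continuous_on_subset) simp
qed

lemma cos_nat_period: "cos (real k * (t + 2 * pi) - b) = cos (real k * t - b)"
proof -
  have "real k * (t + 2 * pi) - b = (real k * t - b) + 2 * pi * of_int (int k)"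
    by (simp add: algebra_simps)
  then show ?thesis
    using periodic_plus_int[of cos "real k * t - b" "int k"] by (simp only: cos_periodic)
qed

lemma trig_kernel_periodic: "trig_kernel c n b (t + 2 * pi) = trig_kernel c n b t"
  unfolding trig_kernel_def cos_nat_period ..

lemma trig_kernel_cmult:
  assumes "summable (\<lambda>j. \<bar>c j\<bar>)"
  shows "trig_kernel (\<lambda>j. a * c j) n b t = a * trig_kernel c n b t"
  unfolding trig_kernel_def
  using suminf_mult[OF summable_trig_kernel[OF assms], of a] by (simp add: mult.assoc del: of_nat_add)

lemma trig_kernel_diff_le:
  assumes c: "summable (\<lambda>j. \<bar>c j\<bar>)" and d: "summable (\<lambda>j. \<bar>d j\<bar>)"
  shows "\<bar>trig_kernel c n b t - trig_kernel d n b t\<bar> \<le> (\<Sum>j. \<bar>c j - d j\<bar>)"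
proof -
  have s: "summable (\<lambda>j. \<bar>c j - d j\<bar>)"
    by (rule summable_comparison_test'[OF summable_add[OF c d]]) (auto intro: abs_triangle_ineq4)
  have "trig_kernel c n b t - trig_kernel d n b t = (\<Sum>j. (c j - d j) * cos (real (j + n) * t - b))"
    unfolding trig_kernel_def
    by (subst suminf_diff[OF summable_trig_kernel[OF c] summable_trig_kernel[OF d]])
       (simp add: left_diff_distrib del: of_nat_add)
  moreover have "norm (\<Sum>j. (c j - d j) * cos (real (j + n) * t - b)) \<le> (\<Sum>j. \<bar>c j - d j\<bar>)"
    by (rule norm_suminf_le[OF _ s]) (simp add: trig_kernel_term_le del: of_nat_add)
  ultimately show ?thesis by simp
qed

text \<open>The numbers \<open>\<alpha> k\<close> and \<open>\<gamma> k\<close> are attached to the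
  frequency and not to the position in the series. This allows a comparison, term by term, of the
  convolution with the full kernel and the one with its tail.\<close>

lemma convolution_trig_kernel:
  fixes \<phi> :: "real \<Rightarrow> real" and b :: real
  assumes \<phi>: "integrable period_measure \<phi>" and c: "summable (\<lambda>j. \<bar>c j\<bar>)"
  defines "\<alpha> \<equiv> \<lambda>k. \<integral>u. \<phi> u * cos (real k * u + b) \<partial>period_measure"
    and "\<gamma> \<equiv> \<lambda>k. \<integral>u. \<phi> u * sin (real k * u + b) \<partial>period_measure"
  shows "(\<lambda>j. c j * (\<alpha> (j + n) * cos (real (j + n) * x) + \<gamma> (j + n) * sin (real (j + n) * x)))
           sums (\<integral>u. \<phi> u * trig_kernel c n b (x - u) \<partial>period_measure)"
proof -
  have meas[measurable]: "\<phi> \<in> borel_measurable period_measure"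
    using \<phi> by (rule borel_measurable_integrable)
  have cm[measurable]: "(\<lambda>u. cos (k * (x - u) - b)) \<in> borel_measurable period_measure"
    "(\<lambda>u. cos (k * u + b)) \<in> borel_measurable period_measure"
    "(\<lambda>u. sin (k * u + b)) \<in> borel_measurable period_measure" for k
    by (intro period_measurable_continuous continuous_intros)+
  have int: "integrable period_measure (\<lambda>u. \<phi> u * cos (k * u + b))"
    "integrable period_measure (\<lambda>u. \<phi> u * sin (k * u + b))" for k
    by (auto intro!: Bochner_Integration.integrable_bound[OF \<phi>] AE_I2 simp: abs_mult mult_left_le)
  have tm: "(\<integral>u. \<phi> u * (c j * cos (real (j + n) * (x - u) - b)) \<partial>period_measure) =
      c j * (\<alpha> (j + n) * cos (real (j + n) * x) + \<gamma> (j + n) * sin (real (j + n) * x))" for j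
  proof -
    define k where "k = real (j + n)"
    have e: "\<phi> u * (c j * cos (k * (x - u) - b)) =
        c j * ((\<phi> u * cos (k * u + b)) * cos (k * x) + (\<phi> u * sin (k * u + b)) * sin (k * x))" for u
      using cos_diff[of "k * x" "k * u + b"] by (simp add: algebra_simps)
    show ?thesis
      unfolding \<alpha>_def \<gamma>_def k_def[symmetric] e using int[of k] by simp
  qed
  have "(\<lambda>j. \<integral>u. \<phi> u * (c j * cos (real (j + n) * (x - u) - b)) \<partial>period_measure) sums
      (\<integral>u. (\<Sum>j. \<phi> u * (c j * cos (real (j + n) * (x - u) - b))) \<partial>period_measure)"
  proof (rule sums_integral_dominated[OF _ _ _ c])
    show "integrable period_measure (\<lambda>u. \<bar>\<phi> u\<bar>)" using \<phi> by simp
    show "norm (\<phi> u * (c j * cos (real (j + n) * (x - u) - b))) \<le> \<bar>c j\<bar> * \<bar>\<phi> u\<bar>" for j u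
      unfolding real_norm_def abs_mult[of "\<phi> u"] mult.commute[of "\<bar>c j\<bar>"]
      by (rule mult_left_mono[OF trig_kernel_term_le]) simp
  qed measurable
  then show ?thesis
    unfolding tm trig_kernel_def
    using suminf_mult[OF summable_trig_kernel[OF c]] by (simp del: of_nat_add)
qed

lemma B01D:
  assumes "\<phi> \<in> B01"
  shows "\<phi> (t + 2 * pi) = \<phi> t" and "integrable period_measure \<phi>"
    and "(\<integral>t. \<bar>\<phi> t\<bar> \<partial>period_measure) \<le> 1"
proof -
  from assms have per: "\<forall>t. \<phi> (t + 2 * pi) = \<phi> t" and "\<phi> \<in> borel_measurable lebesgue"
    and L: "Lp_norm 1 \<phi> \<le> 1"
    by (auto simp: B01_def Lp_space_def)
  show "\<phi> (t + 2 * pi) = \<phi> t" using per by blast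
  have m[measurable]: "\<phi> \<in> borel_measurable period_measure"
    by (rule measurable_restrict_space1) fact
  define I where "I = (\<integral>\<^sup>+t. ennreal \<bar>\<phi> t\<bar> \<partial>period_measure)"
  have I: "I \<noteq> \<infinity>" "enn2real I \<le> 1"
    using L unfolding Lp_norm_def I_def by (auto simp: Let_def split: if_splits)
  show i: "integrable period_measure \<phi>"
    using I(1) unfolding I_def by (intro integrableI_bounded m) (simp add: top.not_eq_extremum)
  have "ennreal (\<integral>t. \<bar>\<phi> t\<bar> \<partial>period_measure) = I"
    unfolding I_def using i by (intro nn_integral_eq_integral[symmetric]) auto
  then show "(\<integral>t. \<bar>\<phi> t\<bar> \<partial>period_measure) \<le> 1"
    using I(2) by (metis enn2real_ennreal integral_nonneg_AE AE_I2 abs_ge_zero)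
qed

lemma weyl_nagy_remainder:
  assumes \<phi>: "\<phi> \<in> B01" and r: "r > 1" and n: "n \<ge> 1"
    and f: "\<And>x. f x = a0 / 2 +
          1 / pi * (\<integral>t. \<phi> (x - t) * weyl_nagy_kernel r \<beta> t \<partial>lebesgue_on {-pi..pi})"
  shows "f x - fourier_sum (n - 1) f x =
    1 / pi * (\<integral>u. \<phi> u * trig_kernel (\<lambda>j. real (j + n) powr (- r)) n (\<beta> * pi / 2) (x - u) \<partial>period_measure)"
proof -
  note \<phi>D = B01D[OF \<phi>]
  define b where "b = \<beta> * pi / 2"
  define c where "c k j = real (j + k) powr (- r)" for k j
  define \<alpha> where "\<alpha> k = (\<integral>u. \<phi> u * cos (real k * u + b) \<partial>period_measure)" for k
  define \<gamma> where "\<gamma> k = (\<integral>u. \<phi> u * sin (real k * u + b) \<partial>period_measure)" for k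
  have "summable (\<lambda>j. real j powr (- r))" using r by (simp add: summable_real_powr_iff)
  then have c: "summable (\<lambda>j. \<bar>c k j\<bar>)" for k
    unfolding c_def using summable_ignore_initial_segment[of "\<lambda>j. real j powr (- r)" k] by simp
  have W: "weyl_nagy_kernel r \<beta> = trig_kernel (c 1) 1 b"
    unfolding weyl_nagy_kernel_def[abs_def] trig_kernel_def[abs_def] c_def b_def by simp
  have conv: "(\<lambda>j. c k j * (\<alpha> (j + k) * cos (real (j + k) * x) + \<gamma> (j + k) * sin (real (j + k) * x)))
       sums (\<integral>u. \<phi> u * trig_kernel (c k) k b (x - u) \<partial>period_measure)" for k x
    unfolding \<alpha>_def \<gamma>_def by (rule convolution_trig_kernel[OF \<phi>D(2) c])
  define A where "A j = 1 / pi * (c 1 j * \<alpha> (Suc j))" for j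
  define B where "B j = 1 / pi * (c 1 j * \<gamma> (Suc j))" for j
  define T where "T j x = A j * cos (real (Suc j) * x) + B j * sin (real (Suc j) * x)" for j x
  have \<phi>m[measurable]: "\<phi> \<in> borel_measurable period_measure"
    using \<phi>D(2) by (rule borel_measurable_integrable)
  have int1: "\<bar>\<integral>u. \<phi> u * w u \<partial>period_measure\<bar> \<le> 1"
    if w: "continuous_on {-pi..pi} w" "\<And>u. \<bar>w u\<bar> \<le> 1" for w
  proof -
    have [measurable]: "w \<in> borel_measurable period_measure"
      by (rule period_measurable_continuous[OF w(1)])
    have "integrable period_measure (\<lambda>u. \<bar>\<phi> u * w u\<bar>)"
      using w(2) by (auto intro!: Bochner_Integration.integrable_bound[OF \<phi>D(2)] AE_I2 simp: abs_mult mult_left_le)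
    then have "(\<integral>u. \<bar>\<phi> u * w u\<bar> \<partial>period_measure) \<le> (\<integral>u. \<bar>\<phi> u\<bar> \<partial>period_measure)"
      using w(2) \<phi>D(2) by (intro integral_mono) (auto simp only: abs_mult mult_left_le abs_ge_zero integrable_abs)
    then show ?thesis
      using integral_abs_bound[of period_measure "\<lambda>u. \<phi> u * w u"] \<phi>D(3) by linarith
  qed
  have \<alpha>1: "\<bar>\<alpha> k\<bar> \<le> 1" and \<gamma>1: "\<bar>\<gamma> k\<bar> \<le> 1" for k
    unfolding \<alpha>_def \<gamma>_def by (auto intro!: int1 continuous_intros)
  have sA: "summable (\<lambda>j. \<bar>A j\<bar>)" and sB: "summable (\<lambda>j. \<bar>B j\<bar>)"
    unfolding A_def B_def abs_mult
    by (intro summable_mult summable_comparison_test'[OF c[of 1]];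
        simp add: mult_left_le \<alpha>1 \<gamma>1)+
  have fx: "f x = a0 / 2 + (\<Sum>j. T j x)" for x
  proof -
    have "(\<integral>t. \<phi> (x - t) * weyl_nagy_kernel r \<beta> t \<partial>lebesgue_on {-pi..pi}) =
        (\<integral>u. \<phi> u * trig_kernel (c 1) 1 b (x - u) \<partial>period_measure)"
      unfolding W
    proof (rule convolution_commute)
      show "\<phi> absolutely_integrable_on {-pi..pi}"
        using \<phi>D(2) by (simp add: set_integrable_def integrable_restrict_space)
    qed (use \<phi>D(1) trig_kernel_periodic continuous_trig_kernel[OF c] in auto)
    also have "\<dots> = (\<Sum>j. c 1 j * (\<alpha> (j + 1) * cos (real (j + 1) * x) + \<gamma> (j + 1) * sin (real (j + 1) * x)))"
      using conv[of 1 x] by (simp only: sums_iff)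
    also have "1 / pi * \<dots> = (\<Sum>j. T j x)"
      using sums_summable[OF conv[of 1 x]]
      by (subst suminf_mult[symmetric]) (simp_all add: T_def A_def B_def algebra_simps)
    finally show ?thesis unfolding f[of x] by simp
  qed
  note S = fourier_sum_trigonometric_series[OF sA sB, of f "a0 / 2", folded T_def, OF fx]
  have "f x - fourier_sum (n - 1) f x = (\<Sum>j. T j x) - (\<Sum>j<n - 1. T j x)"
    unfolding fx[of x] S(1) by simp
  also have "\<dots> = (\<Sum>j. T (j + (n - 1)) x)"
    using suminf_minus_initial_segment[OF S(2)[of x]] by simp
  also have "\<dots> = (\<Sum>j. 1 / pi * (c n j * (\<alpha> (j + n) * cos (real (j + n) * x) + \<gamma> (j + n) * sin (real (j + n) * x))))"
  proof (rule suminf_cong)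
    fix j
    \<comment> \<open>Harmonics are counted from 1 in \<open>T\<close> and from \<open>n\<close> in
      the tail. Dropping n - 1 positions aligns them, with n \<ge> 1 keeping the natural subtraction
      honest.\<close>
    have "Suc (j + (n - 1)) = j + n" using n by simp
    moreover have "c 1 (j + (n - 1)) = c n j" using n by (simp add: c_def of_nat_diff)
    ultimately show "T (j + (n - 1)) x = 1 / pi * (c n j * (\<alpha> (j + n) * cos (real (j + n) * x) + \<gamma> (j + n) * sin (real (j + n) * x)))"
      unfolding T_def A_def B_def by (simp add: algebra_simps del: of_nat_Suc of_nat_add)
  qed
  also have "\<dots> = 1 / pi * (\<integral>u. \<phi> u * trig_kernel (c n) n b (x - u) \<partial>period_measure)"
    using conv[of n x] by (subst suminf_mult) (auto simp: sums_iff)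
  finally show ?thesis unfolding c_def[abs_def] b_def .
qed

text \<open>The free constant \<open>a0\<close> cancels in the remainder, so the supremum over the
  class is one over \<open>\<phi>\<close> alone.\<close>

lemma fourier_approx_error_weyl_nagy:
  assumes "r > 1" and "n \<ge> 1"
  shows "fourier_approx_error n (weyl_nagy_class r \<beta>) s = (SUP \<phi>\<in>B01. Lp_norm s (\<lambda>x. 1 / pi *
    (\<integral>u. \<phi> u * trig_kernel (\<lambda>j. real (j + n) powr (- r)) n (\<beta> * pi / 2) (x - u) \<partial>period_measure)))"
    (is "_ = (SUP \<phi>\<in>B01. Lp_norm s (?R \<phi>))")
proof -
  have "(\<lambda>f. Lp_norm s (\<lambda>x. f x - fourier_sum (n - 1) f x)) ` weyl_nagy_class r \<beta> =
      (\<lambda>\<phi>. Lp_norm s (?R \<phi>)) ` B01" (is "?L ` _ = ?RR ` _")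
  proof (intro equalityI image_subsetI)
    fix f assume "f \<in> weyl_nagy_class r \<beta>"
    then obtain a0 \<phi> where \<phi>: "\<phi> \<in> B01" and f: "\<And>x. f x = a0 / 2 +
          1 / pi * (\<integral>t. \<phi> (x - t) * weyl_nagy_kernel r \<beta> t \<partial>lebesgue_on {-pi..pi})"
      unfolding weyl_nagy_class_def by blast
    have "?L f = ?RR \<phi>"
      by (simp only: weyl_nagy_remainder[OF \<phi> assms f])
    then show "?L f \<in> ?RR ` B01" using \<phi> by blast
  next
    fix \<phi> assume \<phi>: "\<phi> \<in> B01"
    define f where "f x = 0 / 2 +
          1 / pi * (\<integral>t. \<phi> (x - t) * weyl_nagy_kernel r \<beta> t \<partial>lebesgue_on {-pi..pi})" for x
    have "f \<in> weyl_nagy_class r \<beta>"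
      unfolding weyl_nagy_class_def f_def using \<phi> by blast
    moreover have "?L f = ?RR \<phi>"
      by (simp only: weyl_nagy_remainder[OF \<phi> assms f_def])
    ultimately show "?RR \<phi> \<in> ?L ` weyl_nagy_class r \<beta>" by (intro rev_image_eqI[where x=f]) auto
  qed
  then show ?thesis unfolding fourier_approx_error_def by (rule arg_cong)
qed

section \<open>Norms on a period\<close>

text \<open>A real-valued substitute for \<open>Lp_norm\<close> at finite exponents. Kernels and
  remainders are continuous, and there the two agree by \<open>Lp_norm_eq_lp\<close>.\<close>

definition lp :: "real \<Rightarrow> (real \<Rightarrow> real) \<Rightarrow> real" where
  "lp p f = integral {-pi..pi} (\<lambda>t. \<bar>f t\<bar> powr p) powr (1 / p)"

lemma continuous_abs_powr:
  fixes f :: "'a::topological_space \<Rightarrow> real"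
  assumes "continuous_on S f" and "p \<ge> 1"
  shows "continuous_on S (\<lambda>t. \<bar>f t\<bar> powr p)"
  using assms by (intro continuous_on_powr' continuous_intros) auto

lemma lp_nonneg: "0 \<le> lp p f"
  by (simp add: lp_def)

lemma lp_powr:
  assumes "p \<ge> 1"
  shows "lp p f powr p = integral {-pi..pi} (\<lambda>t. \<bar>f t\<bar> powr p)"
proof -
  have "0 \<le> integral {-pi..pi} (\<lambda>t. \<bar>f t\<bar> powr p)"
    by (cases "(\<lambda>t. \<bar>f t\<bar> powr p) integrable_on {-pi..pi}")
       (auto intro: integral_nonneg simp: not_integrable_integral)
  then show ?thesis using assms unfolding lp_def by (simp add: powr_powr)
qed

lemma nn_integral_abs_powr:
  assumes "continuous_on {-pi..pi} f" and "p \<ge> 1"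
  shows "(\<integral>\<^sup>+t. ennreal (\<bar>f t\<bar> powr p) \<partial>period_measure) = ennreal (lp p f powr p)"
proof -
  note c = continuous_abs_powr[OF assms]
  show ?thesis
    unfolding lp_powr[OF assms(2)] period_integral_continuous[OF c, symmetric]
    by (rule nn_integral_eq_integral[OF period_integrable_continuous[OF c]]) simp
qed

lemma Lp_norm_eq_lp:
  assumes "continuous_on {-pi..pi} f" and "p \<ge> 1"
  shows "Lp_norm (ereal p) f = ereal (lp p f)"
  using assms(2) by (simp add: Lp_norm_def nn_integral_abs_powr[OF assms] powr_powr lp_nonneg)

section \<open>Convexity of powers, and norms of nearby functions\<close>

lemma powr_above_tangent:
  fixes a y p :: real
  assumes a: "a > 0" and y: "y \<ge> 0" and p: "p \<ge> 1"
  shows "a powr p + p * a powr (p - 1) * (y - a) \<le> y powr p"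
proof (cases "y = 0")
  case True
  have e: "a powr (p - 1) * a = a powr p"
    using a by (simp add: powr_diff)
  have "p * a powr (p - 1) * (y - a) = - (p * (a powr (p - 1) * a))"
    unfolding True by (simp only: diff_0 mult_minus_right mult.assoc)
  then have "a powr p + p * a powr (p - 1) * (y - a) = a powr p - p * a powr p"
    unfolding e by (simp only: diff_conv_add_uminus)
  also have "\<dots> \<le> 0" using mult_right_mono[OF p, of "a powr p"] by simp
  also have "0 \<le> y powr p" by (rule powr_ge_zero)
  finally show ?thesis .
next
  case False
  have "p * a powr (p - 1) * (y - a) \<le> y powr p - a powr p"
  proof (rule convex_on_imp_above_tangent[OF powr_convex[OF p]])
    show "((\<lambda>x. x powr p) has_real_derivative p * a powr (p - 1)) (at a within {0<..})"
      using a by (rule has_field_derivative_at_within[OF has_real_derivative_powr])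
  qed (use a y False in \<open>auto simp: interior_open\<close>)
  then show ?thesis by simp
qed

text \<open>The tangent at the combined point z lies below the power at x and at y. Averaging with
  the weights l and 1 - l removes its linear part.\<close>

lemma powr_convex_comb:
  fixes x y p l :: real
  assumes "x \<ge> 0" "y \<ge> 0" "0 \<le> l" "l \<le> 1" and p: "p \<ge> 1"
  shows "(l * x + (1 - l) * y) powr p \<le> l * x powr p + (1 - l) * y powr p"
proof -
  define z where "z = l * x + (1 - l) * y"
  have "z \<ge> 0" unfolding z_def using assms by simp
  show ?thesis
  proof (cases "z = 0")
    case False
    with \<open>z \<ge> 0\<close> have z: "z > 0" by simp
    let ?d = "p * z powr (p - 1)"
    have "l * (z powr p + ?d * (x - z)) + (1 - l) * (z powr p + ?d * (y - z)) \<le>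
        l * x powr p + (1 - l) * y powr p"
      using assms by (intro add_mono mult_left_mono powr_above_tangent z) auto
    moreover have "l * (z powr p + ?d * (x - z)) + (1 - l) * (z powr p + ?d * (y - z)) =
        z powr p + ?d * (l * x + (1 - l) * y - z)" by (simp add: algebra_simps)
    ultimately show ?thesis by (simp add: z_def)
  qed (use assms in \<open>simp add: z_def\<close>)
qed

lemma powr_le_powrD:
  fixes x y p :: real
  assumes "x powr p \<le> y powr p" and "0 \<le> x" "0 \<le> y" and p: "p \<ge> 1"
  shows "x \<le> y"
proof (rule ccontr)
  assume "\<not> x \<le> y"
  then have "y powr p < x powr p" using assms by (intro powr_less_mono2) auto
  then show False using assms(1) by simp
qed

text \<open>This is Minkowski's inequality against a constant, in a form whose constant does not
  depend on \<open>p\<close>. All uniformity in \<open>p\<close> rests on it.\<close>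

lemma lp_perturb:
  assumes f: "continuous_on {-pi..pi} f" and g: "continuous_on {-pi..pi} g" and p: "p \<ge> 1"
    and d: "\<And>t. t \<in> {-pi..pi} \<Longrightarrow> \<bar>f t - g t\<bar> \<le> d"
  shows "lp p f \<le> lp p g + 2 * pi * d"
proof (cases "d = 0")
  case True
  have "lp p f = lp p g"
    unfolding lp_def using d True by (intro arg_cong[where f="\<lambda>x. x powr _"] integral_cong) auto
  then show ?thesis using True by simp
next
  case False
  have "0 \<le> d" using d[of 0] by (intro order.trans[OF abs_ge_zero]) auto
  with False have d0: "d > 0" by simp
  \<comment> \<open>The p-norm of the constant \<open>d\<close> over a period; the factor (2
    pi)^(1/p) is at most 2 pi.\<close>
  define B where "B = (2 * pi) powr (1 / p) * d"
  have B0: "B > 0" using d0 by (simp add: B_def)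
  have dB: "(d / B) powr p * (2 * pi) = 1"
    using d0 p by (simp add: B_def powr_divide powr_mult powr_powr)
  \<comment> \<open>Write |g| + d as A + B times the convex combination of |g|/A and d/B with
    weights A/(A + B) and B/(A + B), then apply convexity pointwise. Taking \<open>A\<close>
    strictly above the norm of \<open>g\<close> keeps the division legitimate if that norm is 0; at
    the end \<open>A\<close> tends to it.\<close>
  have main: "lp p f \<le> A + B" if A: "A > lp p g" for A
  proof -
    have A0: "A > 0" using A lp_nonneg[of p g] by simp
    define l where "l = A / (A + B)"
    have l: "0 \<le> l" "l \<le> 1" using A0 B0 by (auto simp: l_def)
    have l': "1 - l = B / (A + B)" using A0 B0 by (simp add: l_def field_simps)
    have pt: "\<bar>f t\<bar> powr p \<le> (A + B) powr p * (l / A powr p * \<bar>g t\<bar> powr p + (1 - l) * (d / B) powr p)"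
      if t: "t \<in> {-pi..pi}" for t
    proof -
      have "l * (\<bar>g t\<bar> / A) + (1 - l) * (d / B) = (\<bar>g t\<bar> + d) / (A + B)"
        unfolding l' using A0 B0 by (simp add: l_def add_divide_distrib)
      then have e: "\<bar>g t\<bar> + d = (A + B) * (l * (\<bar>g t\<bar> / A) + (1 - l) * (d / B))"
        using A0 B0 by simp
      have "\<bar>f t\<bar> powr p \<le> (\<bar>g t\<bar> + d) powr p"
        using d[OF t] p by (intro powr_mono2) auto
      also have "\<dots> = (A + B) powr p * (l * (\<bar>g t\<bar> / A) + (1 - l) * (d / B)) powr p"
        unfolding e using A0 B0 l d0 by (intro powr_mult)
      also have "\<dots> \<le> (A + B) powr p * (l * (\<bar>g t\<bar> / A) powr p + (1 - l) * (d / B) powr p)"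
        using A0 B0 l d0 p by (intro mult_left_mono powr_convex_comb) auto
      finally show ?thesis using A0 by (simp add: powr_divide)
    qed
    note ig = integrable_continuous_real[OF continuous_abs_powr[OF g p]]
      and if' = integrable_continuous_real[OF continuous_abs_powr[OF f p]]
    define G where "G = integral {-pi..pi} (\<lambda>t. \<bar>g t\<bar> powr p)"
    define u v where "u = l / A powr p" and "v = (1 - l) * (d / B) powr p"
    have g1: "((\<lambda>t. \<bar>g t\<bar> powr p) has_integral G) {-pi..pi}"
      unfolding G_def by (rule integrable_integral[OF ig])
    have "((\<lambda>t. v) has_integral (2 * pi * v)) {-pi..pi}"
      using has_integral_const_real[of v "-pi" pi] by simp
    from has_integral_mult_right[OF has_integral_add[OF has_integral_mult_right[OF g1, of u] this], of "(A + B) powr p"]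
    have "((\<lambda>t. (A + B) powr p * (u * \<bar>g t\<bar> powr p + v)) has_integral
        ((A + B) powr p * (u * G + 2 * pi * v))) {-pi..pi}" (is "(?h has_integral ?J) _") .
    from has_integral_le[OF integrable_integral[OF if'] this pt[folded u_def v_def]]
    have "integral {-pi..pi} (\<lambda>t. \<bar>f t\<bar> powr p) \<le> ?J" .
    also have "\<dots> \<le> (A + B) powr p * (l + (1 - l))"
    proof (intro mult_left_mono add_mono)
      have "G \<le> A powr p"
        unfolding G_def lp_powr[OF p, symmetric] using A lp_nonneg[of p g] p by (intro powr_mono2) auto
      then have "u * G \<le> u * A powr p" using l A0 by (intro mult_left_mono) (auto simp: u_def)
      then show "u * G \<le> l" using A0 by (simp add: u_def)
      have "2 * pi * v = (1 - l) * ((d / B) powr p * (2 * pi))" by (simp add: v_def)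
      then show "2 * pi * v \<le> 1 - l" by (simp add: dB)
    qed simp
    also have "\<dots> = (A + B) powr p" by simp
    finally have "lp p f powr p \<le> (A + B) powr p" unfolding lp_powr[OF p] .
    then show ?thesis
      by (rule powr_le_powrD[OF _ lp_nonneg _ p]) (use A0 B0 in simp)
  qed
  have "B \<le> 2 * pi * d"
  proof -
    have "(2 * pi) powr (1 / p) \<le> (2 * pi) powr 1"
      using p pi_gt3 by (intro powr_mono) auto
    then show ?thesis unfolding B_def using d0 by (intro mult_right_mono) auto
  qed
  moreover have "lp p f \<le> lp p g + B"
  proof (rule field_le_epsilon)
    fix e :: real assume "0 < e"
    then show "lp p f \<le> lp p g + B + e" using main[of "lp p g + e"] by simp
  qed
  ultimately show ?thesis by simp
qed

text \<open>Continuity is inherited from the kernel by dominated convergence with majorant C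
  |\<phi>|. It makes \<open>lp\<close> applicable to remainders although \<open>\<phi>\<close> is
  only integrable.\<close>

lemma continuous_convolution:
  fixes \<phi> K :: "real \<Rightarrow> real" and S :: "real set"
  assumes \<phi>: "integrable period_measure \<phi>" and K: "continuous_on UNIV K" "\<And>t. \<bar>K t\<bar> \<le> C"
  shows "continuous_on S (\<lambda>x. \<integral>u. \<phi> u * K (x - u) \<partial>period_measure)"
  unfolding continuous_on_sequentially o_def
proof safe
  fix X :: "nat \<Rightarrow> real" and a assume X: "X \<longlonglongrightarrow> a"
  have [measurable]: "\<phi> \<in> borel_measurable period_measure"
    using \<phi> by (rule borel_measurable_integrable)
  have Kc: "continuous_on A (\<lambda>u. K (x - u))" for A x
    by (intro continuous_on_compose2[OF K(1)] continuous_intros) auto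
  have [measurable]: "(\<lambda>u. K (x - u)) \<in> borel_measurable period_measure" for x
    by (rule period_measurable_continuous[OF Kc])
  show "(\<lambda>n. \<integral>u. \<phi> u * K (X n - u) \<partial>period_measure) \<longlonglongrightarrow> (\<integral>u. \<phi> u * K (a - u) \<partial>period_measure)"
  proof (rule integral_dominated_convergence)
    show "integrable period_measure (\<lambda>u. \<bar>\<phi> u\<bar> * C)" using \<phi> by simp
    show "AE u in period_measure. (\<lambda>n. \<phi> u * K (X n - u)) \<longlonglongrightarrow> \<phi> u * K (a - u)"
    proof (rule AE_I2, rule tendsto_mult_left)
      fix u
      show "(\<lambda>n. K (X n - u)) \<longlonglongrightarrow> K (a - u)"
        using K(1) X by (intro continuous_on_tendsto_compose[OF K(1)] tendsto_diff) auto
    qed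
    show "AE u in period_measure. norm (\<phi> u * K (X n - u)) \<le> \<bar>\<phi> u\<bar> * C" for n
      using K(2) by (intro AE_I2) (auto simp: abs_mult intro: mult_left_mono)
  qed measurable
qed

text \<open>A Jensen-type bound with weight |\<phi>| controls the p-th power of the convolution at
  each point. After exchanging the integrals, translation invariance turns the inner one into the
  p-integral of \<open>K\<close>, and the remaining mass of |\<phi>| is at most 1.\<close>

lemma lp_convolution_le:
  fixes \<phi> K :: "real \<Rightarrow> real"
  assumes \<phi>: "integrable period_measure \<phi>" "(\<integral>u. \<bar>\<phi> u\<bar> \<partial>period_measure) \<le> 1"
    and K: "continuous_on UNIV K" "\<And>t. \<bar>K t\<bar> \<le> C" "\<And>t. K (t + 2 * pi) = K t" and p: "p \<ge> 1"
  shows "lp p (\<lambda>x. \<integral>u. \<phi> u * K (x - u) \<partial>period_measure) \<le> lp p K"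
proof -
  define F where "F x = (\<integral>u. \<phi> u * K (x - u) \<partial>period_measure)" for x
  define m where "m = (\<integral>u. \<bar>\<phi> u\<bar> \<partial>period_measure)"
  have C0: "C \<ge> 0" using K(2)[of 0] by (intro order.trans[OF abs_ge_zero])
  have \<phi>m[measurable]: "\<phi> \<in> borel_measurable period_measure"
    using \<phi>(1) by (rule borel_measurable_integrable)
  \<comment> \<open>With \<open>K\<close> Borel and the identity measurable from the period into the
    Borel line, K (x - u) is jointly measurable for the product of the two completed measures, as
    the exchange of integrals requires.\<close>
  have [measurable]: "K \<in> borel_measurable borel"
    by (rule borel_measurable_continuous_onI[OF K(1)])
  have idm[measurable]: "(\<lambda>x. x) \<in> period_measure \<rightarrow>\<^sub>M (borel :: real measure)"
    by (rule period_measurable_continuous) (intro continuous_intros)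
  have int: "integrable period_measure (\<lambda>u. \<bar>\<phi> u\<bar> * w u)"
    if [measurable]: "w \<in> borel_measurable period_measure" and "\<And>u. \<bar>w u\<bar> \<le> D" for w and D :: real
  proof (rule Bochner_Integration.integrable_bound)
    show "integrable period_measure (\<lambda>u. \<phi> u * D)" using \<phi>(1) by simp
    show "AE u in period_measure. norm (\<bar>\<phi> u\<bar> * w u) \<le> norm (\<phi> u * D)"
      by (intro AE_I2) (simp add: abs_mult mult_left_mono order.trans[OF that(2) abs_ge_self])
  qed measurable
  have intK: "integrable period_measure (\<lambda>u. \<bar>\<phi> u\<bar> * \<bar>K (x - u)\<bar>)"
    "integrable period_measure (\<lambda>u. \<bar>\<phi> u\<bar> * \<bar>K (x - u)\<bar> powr p)" for x
    by (rule int[where D=C]; use K(2) in simp)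
       (rule int[where D="C powr p"]; use K(2) p in \<open>simp add: powr_mono2\<close>)
  \<comment> \<open>The tangent of \<open>y powr p\<close> at the mean \<open>a\<close> replaces Jensen's inequality: the total mass \<open>m\<close> is
    only at most \<open>1\<close>, but \<open>m + p (1 - m) \<ge> 1\<close>.\<close>
  have jensen: "\<bar>F x\<bar> powr p \<le> (\<integral>u. \<bar>\<phi> u\<bar> * \<bar>K (x - u)\<bar> powr p \<partial>period_measure)" for x
  proof -
    define a where "a = (\<integral>u. \<bar>\<phi> u\<bar> * \<bar>K (x - u)\<bar> \<partial>period_measure)"
    have Fa: "\<bar>F x\<bar> \<le> a"
      unfolding F_def a_def abs_mult[symmetric] by (rule integral_abs_bound)
    show ?thesis
    proof (cases "a = 0")
      case True
      then show ?thesis using Fa p by simp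
    next
      case False
      then have a0: "a > 0" using Fa by linarith
      have "a powr p * (m + p * (1 - m)) =
        (\<integral>u. \<bar>\<phi> u\<bar> * (a powr p + p * a powr (p - 1) * (\<bar>K (x - u)\<bar> - a)) \<partial>period_measure)"
      proof -
        have "(\<integral>u. \<bar>\<phi> u\<bar> * (a powr p + p * a powr (p - 1) * (\<bar>K (x - u)\<bar> - a)) \<partial>period_measure) =
          (\<integral>u. (a powr p - p * a powr (p - 1) * a) * \<bar>\<phi> u\<bar> +
            p * a powr (p - 1) * (\<bar>\<phi> u\<bar> * \<bar>K (x - u)\<bar>) \<partial>period_measure)"
          by (intro Bochner_Integration.integral_cong) (auto simp: algebra_simps)
        also have "\<dots> = (a powr p - p * a powr (p - 1) * a) * m + p * a powr (p - 1) * a"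
          using \<phi>(1) intK(1)[of x] by (simp add: m_def a_def)
        also have "\<dots> = a powr p * (m + p * (1 - m))"
          using a0 by (simp add: powr_diff algebra_simps)
        finally show ?thesis by simp
      qed
      also have "\<dots> \<le> (\<integral>u. \<bar>\<phi> u\<bar> * \<bar>K (x - u)\<bar> powr p \<partial>period_measure)"
      proof (rule integral_mono)
        have "integrable period_measure (\<lambda>u. (a powr p - p * a powr (p - 1) * a) * \<bar>\<phi> u\<bar> +
            p * a powr (p - 1) * (\<bar>\<phi> u\<bar> * \<bar>K (x - u)\<bar>))"
          using \<phi>(1) intK(1)[of x] by simp
        then show "integrable period_measure (\<lambda>u. \<bar>\<phi> u\<bar> * (a powr p + p * a powr (p - 1) * (\<bar>K (x - u)\<bar> - a)))"
          by (rule Bochner_Integration.integrable_cong[THEN iffD1, rotated -1]) (auto simp: algebra_simps)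
        show "\<bar>\<phi> u\<bar> * (a powr p + p * a powr (p - 1) * (\<bar>K (x - u)\<bar> - a)) \<le> \<bar>\<phi> u\<bar> * \<bar>K (x - u)\<bar> powr p" for u
          by (intro mult_left_mono powr_above_tangent a0 p) auto
      qed (rule intK)
      finally have "a powr p * (m + p * (1 - m)) \<le> (\<integral>u. \<bar>\<phi> u\<bar> * \<bar>K (x - u)\<bar> powr p \<partial>period_measure)" .
      moreover have "0 \<le> (p - 1) * (1 - m)" using p \<phi>(2) by (simp add: m_def)
      then have "a powr p * 1 \<le> a powr p * (m + p * (1 - m))"
        by (intro mult_left_mono) (auto simp: algebra_simps)
      moreover have "\<bar>F x\<bar> powr p \<le> a powr p" using Fa p by (intro powr_mono2) auto
      ultimately show ?thesis by simp
    qed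
  qed
  interpret finite_measure period_measure
    by (rule finite_measure_lebesgue_on) simp
  interpret pair_sigma_finite period_measure period_measure ..
  have "ennreal (lp p F powr p) = (\<integral>\<^sup>+x. ennreal (\<bar>F x\<bar> powr p) \<partial>period_measure)"
    using continuous_convolution[OF \<phi>(1) K(1,2)] p
    by (intro nn_integral_abs_powr[symmetric]) (auto simp: F_def[abs_def])
  also have "\<dots> \<le> (\<integral>\<^sup>+x. (\<integral>\<^sup>+u. ennreal (\<bar>\<phi> u\<bar> * \<bar>K (x - u)\<bar> powr p) \<partial>period_measure) \<partial>period_measure)"
    using jensen intK(2) by (intro nn_integral_mono) (simp add: nn_integral_eq_integral)
  also have "\<dots> = (\<integral>\<^sup>+u. (\<integral>\<^sup>+x. ennreal (\<bar>\<phi> u\<bar> * \<bar>K (x - u)\<bar> powr p) \<partial>period_measure) \<partial>period_measure)"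
    by (rule Fubini') measurable
  also have "\<dots> = (\<integral>\<^sup>+u. ennreal \<bar>\<phi> u\<bar> * ennreal (lp p K powr p) \<partial>period_measure)"
  proof (rule nn_integral_cong)
    fix u
    have Kc: "continuous_on {-pi..pi} (\<lambda>x. K (x - u))"
      by (intro continuous_on_compose2[OF K(1)] continuous_intros) auto
    have "(\<integral>\<^sup>+x. ennreal (\<bar>\<phi> u\<bar> * \<bar>K (x - u)\<bar> powr p) \<partial>period_measure) =
        ennreal \<bar>\<phi> u\<bar> * (\<integral>\<^sup>+x. ennreal (\<bar>K (x - u)\<bar> powr p) \<partial>period_measure)"
      by (simp add: ennreal_mult nn_integral_cmult)
    also have "(\<integral>\<^sup>+x. ennreal (\<bar>K (x - u)\<bar> powr p) \<partial>period_measure) = ennreal (lp p (\<lambda>x. K (x - u)) powr p)"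
      by (rule nn_integral_abs_powr[OF Kc p])
    also have "lp p (\<lambda>x. K (x - u)) = lp p K"
      unfolding lp_def using K(3) continuous_abs_powr[OF K(1) p]
      by (subst integral_periodic_shift[of "\<lambda>t. \<bar>K t\<bar> powr p"]) auto
    finally show "(\<integral>\<^sup>+x. ennreal (\<bar>\<phi> u\<bar> * \<bar>K (x - u)\<bar> powr p) \<partial>period_measure) =
        ennreal \<bar>\<phi> u\<bar> * ennreal (lp p K powr p)" .
  qed
  also have "\<dots> = ennreal (m * lp p K powr p)"
    using \<phi>(1) by (simp add: nn_integral_multc nn_integral_eq_integral m_def ennreal_mult)
  also have "\<dots> \<le> ennreal (1 * lp p K powr p)"
    using \<phi>(2) by (intro ennreal_leI mult_right_mono) (auto simp: m_def)
  finally have "lp p F powr p \<le> lp p K powr p" by (simp add: ennreal_le_iff)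
  then have "lp p F \<le> lp p K"
    by (rule powr_le_powrD) (auto simp: lp_nonneg p)
  then show ?thesis unfolding F_def[abs_def] .
qed

lemma Lp_norm_infinity_le:
  assumes "continuous_on {-pi..pi} f" and "\<And>t. \<bar>f t\<bar> \<le> C"
  shows "Lp_norm \<infinity> f \<le> ereal C"
  using period_measurable_continuous[OF assms(1)] assms(2)
  by (auto simp: Lp_norm_def intro!: esssup_I)

text \<open>Were the essential supremum smaller than |f x|, a level between them would be exceeded
  on a nonempty open set, which is not negligible. The point lies in the open interval so that this
  set is open in the real line.\<close>

lemma Lp_norm_infinity_ge:
  assumes f: "continuous_on {-pi..pi} f" and x: "- pi < x" "x < pi"
  shows "ereal \<bar>f x\<bar> \<le> Lp_norm \<infinity> f"
proof (rule ccontr)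
  assume "\<not> ?thesis"
  then obtain s where s: "Lp_norm \<infinity> f < ereal s" "s < \<bar>f x\<bar>"
    by (meson ereal_dense2 not_le less_ereal.simps(1) ereal_less_ereal_Ex order_less_imp_le)
  define U where "U = {t \<in> {-pi<..<pi}. s < \<bar>f t\<bar>}"
  have U: "open U" "x \<in> U"
  proof -
    have "continuous_on {-pi<..<pi} (\<lambda>t. \<bar>f t\<bar>)"
      by (intro continuous_intros continuous_on_subset[OF f]) auto
    from continuous_open_preimage[OF this, of "{s<..}"]
    have "open ({-pi<..<pi} \<inter> (\<lambda>t. \<bar>f t\<bar>) -` {s<..})" by auto
    also have "{-pi<..<pi} \<inter> (\<lambda>t. \<bar>f t\<bar>) -` {s<..} = U" by (auto simp: U_def)
    finally show "open U" .
  qed (use x s in \<open>simp add: U_def\<close>)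
  have "AE t in period_measure. ereal \<bar>f t\<bar> \<le> esssup period_measure (\<lambda>t. ereal \<bar>f t\<bar>)"
    by (rule esssup_AE)
  then have "AE t in period_measure. \<bar>f t\<bar> < s"
    using s(1) by (auto simp: Lp_norm_def elim!: eventually_mono) (metis le_less_trans less_ereal.simps(1))
  then have "AE t in lebesgue. t \<in> {-pi..pi} \<longrightarrow> \<bar>f t\<bar> < s"
    by (simp add: AE_restrict_space_iff)
  then have "AE t in lebesgue. t \<notin> U"
    by (rule eventually_mono) (auto simp: U_def)
  moreover have "U \<in> sets lebesgue" using U(1) by (simp add: borel_open sets_completionI_sets)
  ultimately have "U \<in> null_sets lebesgue" by (simp add: AE_iff_null_sets)
  then show False
    using U by (metis negligible_iff_null_sets open_not_negligible empty_iff)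
qed

section \<open>Comparison of the coefficients with a geometric progression\<close>

lemma sums_mult_power:
  fixes q :: real
  assumes "0 \<le> q" "q < 1"
  shows "(\<lambda>j. real j * q ^ j) sums (q / (1 - q)\<^sup>2)"
proof -
  have "(\<lambda>j. real (Suc j) * q ^ j * q) sums (1 / (1 - q)\<^sup>2 * q)"
    using assms geometric_deriv_sums[of q] by (intro sums_mult2) simp
  then show ?thesis
    using sums_Suc[of "\<lambda>j. real j * q ^ j" "q / (1 - q)\<^sup>2"] by (simp add: mult_ac)
qed

section \<open>Translations of cosine series\<close>

lemma abs_cos_diff_le: "\<bar>cos x - cos y\<bar> \<le> \<bar>x - y :: real\<bar>"
proof -
  have "\<bar>cos x - cos y\<bar> = 2 * \<bar>sin ((x + y) / 2)\<bar> * \<bar>sin ((y - x) / 2)\<bar>"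
    by (simp add: cos_diff_cos abs_mult)
  also have "\<dots> \<le> 2 * 1 * \<bar>(y - x) / 2\<bar>"
    by (intro mult_mono abs_sin_x_le_abs_x) auto
  finally show ?thesis by simp
qed

text \<open>A translation by s moves the argument of term j by (j + n) s. The part n s is common to
  all terms and is absorbed exactly by the phase; only j s is left as error. The weight j kills the
  leading term, so for geometric coefficients the error is of order q and free of n.\<close>

lemma trig_kernel_shift:
  assumes c: "summable (\<lambda>j. \<bar>c j\<bar>)" and jc: "summable (\<lambda>j. real j * \<bar>c j\<bar>)"
  shows "\<bar>trig_kernel c n b (t - s) - trig_kernel c n (b + real n * s) t\<bar> \<le> \<bar>s\<bar> * (\<Sum>j. real j * \<bar>c j\<bar>)"
proof -
  let ?d = "\<lambda>j. cos (real (j + n) * (t - s) - b) - cos (real (j + n) * t - (b + real n * s))"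
  have "trig_kernel c n b (t - s) - trig_kernel c n (b + real n * s) t = (\<Sum>j. c j * ?d j)"
    unfolding trig_kernel_def
    by (subst suminf_diff[OF summable_trig_kernel[OF c] summable_trig_kernel[OF c]])
       (simp add: right_diff_distrib)
  moreover have "norm (c j * ?d j) \<le> \<bar>s\<bar> * (real j * \<bar>c j\<bar>)" for j
  proof -
    have "\<bar>?d j\<bar> \<le> \<bar>real j * s\<bar>"
      by (rule order.trans[OF abs_cos_diff_le]) (simp add: algebra_simps)
    then have "\<bar>c j\<bar> * \<bar>?d j\<bar> \<le> \<bar>c j\<bar> * \<bar>real j * s\<bar>" by (intro mult_left_mono) auto
    then show ?thesis by (simp add: abs_mult mult_ac)
  qed
  then have "norm (\<Sum>j. c j * ?d j) \<le> (\<Sum>j. \<bar>s\<bar> * (real j * \<bar>c j\<bar>))"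
    by (intro norm_suminf_le summable_mult jc)
  ultimately show ?thesis using suminf_mult[OF jc, of "\<bar>s\<bar>"] by simp
qed

text \<open>A cruder bound than \<open>trig_kernel_shift\<close>, with the phase kept. It serves
  only to choose the width of a window, where the size of the constant is immaterial.\<close>

lemma trig_kernel_lipschitz:
  assumes c: "summable (\<lambda>j. \<bar>c j\<bar>)" and jc: "summable (\<lambda>j. real (j + n) * \<bar>c j\<bar>)"
  shows "\<bar>trig_kernel c n b (t - s) - trig_kernel c n b t\<bar> \<le> \<bar>s\<bar> * (\<Sum>j. real (j + n) * \<bar>c j\<bar>)"
proof -
  let ?d = "\<lambda>j. cos (real (j + n) * (t - s) - b) - cos (real (j + n) * t - b)"
  have "trig_kernel c n b (t - s) - trig_kernel c n b t = (\<Sum>j. c j * ?d j)"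
    unfolding trig_kernel_def
    by (subst suminf_diff[OF summable_trig_kernel[OF c] summable_trig_kernel[OF c]])
       (simp add: right_diff_distrib)
  moreover have "norm (c j * ?d j) \<le> \<bar>s\<bar> * (real (j + n) * \<bar>c j\<bar>)" for j
  proof -
    have "\<bar>?d j\<bar> \<le> \<bar>real (j + n) * s\<bar>"
      by (rule order.trans[OF abs_cos_diff_le]) (simp add: right_diff_distrib del: of_nat_add)
    then have "\<bar>c j\<bar> * \<bar>?d j\<bar> \<le> \<bar>c j\<bar> * \<bar>real (j + n) * s\<bar>" by (intro mult_left_mono) auto
    then show ?thesis by (simp add: abs_mult mult_ac)
  qed
  then have "norm (\<Sum>j. c j * ?d j) \<le> (\<Sum>j. \<bar>s\<bar> * (real (j + n) * \<bar>c j\<bar>))"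
    by (intro norm_suminf_le summable_mult jc)
  ultimately show ?thesis using suminf_mult[OF jc, of "\<bar>s\<bar>"] by simp
qed

text \<open>The denominator \<open>1 + x\<close>, instead of the \<open>2\<close> given by Taylor's formula, makes the majorant in
  \<open>coefficient_sum_bound\<close> summable down to \<open>n = 2\<close>, \<open>r = 3\<close>.\<close>

lemma diff_ln_one_plus_bounds:
  fixes x :: real
  assumes "x \<ge> 0"
  shows "0 \<le> x - ln (1 + x)" and "x - ln (1 + x) \<le> x\<^sup>2 / (1 + x)"
proof -
  show "0 \<le> x - ln (1 + x)" using ln_add_one_self_le_self[OF assms] by simp
  have "- ln (1 + x) \<le> 1 / (1 + x) - 1"
    using ln_le_minus_one[of "1 / (1 + x)"] assms by (simp add: ln_div)
  also have "\<dots> = x\<^sup>2 / (1 + x) - x" using assms by (simp add: field_simps power2_eq_square)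
  finally show "x - ln (1 + x) \<le> x\<^sup>2 / (1 + x)" by simp
qed

text \<open>With y = r (x - ln (1 + x)) \<ge> 0 the exponential equals (1 + x)^(-r) exp(-y), and 1 -
  exp(-y) \<le> y. For x = j/n the two quantities are the coefficient of the tail divided by n^(-r)
  and the power q^j.\<close>

lemma powr_sub_exp_bounds:
  fixes x r :: real
  assumes x: "x \<ge> 0" and r: "r \<ge> 0"
  shows "0 \<le> (1 + x) powr (- r) - exp (- r * x)"
    and "(1 + x) powr (- r) - exp (- r * x) \<le> r * x\<^sup>2 * (1 + x) powr (- (r + 1))"
proof -
  define y where "y = r * (x - ln (1 + x))"
  note l = diff_ln_one_plus_bounds[OF x]
  have y0: "0 \<le> y" unfolding y_def using l r by simp
  have e: "exp (- r * x) = (1 + x) powr (- r) * exp (- y)"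
    using x by (simp add: powr_def y_def exp_add[symmetric] algebra_simps)
  have "0 \<le> (1 + x) powr (- r) * (1 - exp (- y))" using y0 by simp
  then show "0 \<le> (1 + x) powr (- r) - exp (- r * x)" unfolding e by (simp add: algebra_simps)
  have "(1 + x) powr (- r) - exp (- r * x) = (1 + x) powr (- r) * (1 - exp (- y))"
    unfolding e by (simp add: algebra_simps)
  also have "\<dots> \<le> (1 + x) powr (- r) * (r * (x\<^sup>2 / (1 + x)))"
  proof (intro mult_left_mono)
    have "1 - exp (- y) \<le> y" using exp_ge_add_one_self[of "- y"] by simp
    also have "y \<le> r * (x\<^sup>2 / (1 + x))" unfolding y_def by (intro mult_left_mono l r)
    finally show "1 - exp (- y) \<le> r * (x\<^sup>2 / (1 + x))" .
  qed simp
  also have "\<dots> = r * x\<^sup>2 * (1 + x) powr (- (r + 1))"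
    using x by (simp add: powr_diff powr_minus field_simps)
  finally show "(1 + x) powr (- r) - exp (- r * x) \<le> r * x\<^sup>2 * (1 + x) powr (- (r + 1))" .
qed

text \<open>Split 1 + j/n into (1 + 1/n)(1 + y). The first factor yields exp(-r/n) up to e \<le> 3,
  since r (1/n - ln (1 + 1/n)) \<le> r/n^2 \<le> 1; the second yields the decay j^(-4). The constant
  is 768 = 3 * 4^4.\<close>

lemma coefficient_bound:
  fixes n j :: nat and r :: real
  assumes n: "real n + 1 \<le> r" "r \<le> (real n)\<^sup>2" "n \<ge> 2" and j: "j \<ge> 1"
  shows "(1 + real j / real n) powr (- (r + 1)) \<le> 768 * exp (- r / real n) / real j ^ 4"
proof -
  define y where "y = (real j - 1) / (real n + 1)"
  have y: "y \<ge> 0" using j by (simp add: y_def)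
  have fac: "1 + real j / real n = (1 + 1 / real n) * (1 + y)"
  proof -
    have "1 + 1 / real n = (real n + 1) / real n" "1 + y = (real n + real j) / (real n + 1)"
      using n(3) by (simp_all add: y_def field_simps)
    then have "(1 + 1 / real n) * (1 + y) = (real n + real j) / real n" by simp
    then show ?thesis using n(3) by (simp add: add_divide_distrib)
  qed
  have "(1 + 1 / real n) powr (- (r + 1)) \<le> (1 + 1 / real n) powr (- r)"
    by (intro powr_mono) auto
  also have "\<dots> = exp (- r / real n) * exp (r * (1 / real n - ln (1 + 1 / real n)))"
  proof -
    have "1 + 1 / real n \<noteq> 0" using add_pos_nonneg[of 1 "1 / real n"] by simp
    then show ?thesis by (simp add: powr_def exp_add[symmetric] algebra_simps)
  qed
  also have "\<dots> \<le> exp (- r / real n) * exp 1"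
  proof (intro mult_left_mono iffD2[OF exp_le_cancel_iff])
    have "1 / real n - ln (1 + 1 / real n) \<le> (1 / real n)\<^sup>2 / (1 + 1 / real n)"
      by (rule diff_ln_one_plus_bounds) simp
    also have "\<dots> \<le> (1 / real n)\<^sup>2 / 1" by (intro divide_left_mono) (auto simp: add_pos_nonneg)
    finally have "r * (1 / real n - ln (1 + 1 / real n)) \<le> r * (1 / real n)\<^sup>2"
      using n(1) by (intro mult_left_mono) auto
    also have "\<dots> \<le> 1" using n by (simp add: power_divide field_simps)
    finally show "r * (1 / real n - ln (1 + 1 / real n)) \<le> 1" .
  qed simp
  also have "\<dots> \<le> exp (- r / real n) * 3" using exp_le by (intro mult_left_mono) auto
  finally have 1: "(1 + 1 / real n) powr (- (r + 1)) \<le> 3 * exp (- r / real n)" by simp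
  \<comment> \<open>A quarter of the exponent is still at least 1 because r \<ge> 3, so Bernoulli's
    inequality gives (1 + y)^s \<ge> 1 + s y \<ge> j/4. The fourth power restores the full
    exponent.\<close>
  define s where "s = (r + 1) / 4"
  have r3: "r \<ge> 3" using n by linarith
  have "real j / 4 \<le> 1 + (real j - 1) / 4" by (simp add: diff_divide_distrib)
  also have "\<dots> \<le> 1 + s * y"
  proof -
    have "(real j - 1) * (real n + 1) \<le> (real j - 1) * (r + 1)"
      using n j by (intro mult_left_mono) auto
    then show ?thesis by (simp add: s_def y_def field_simps)
  qed
  also have "\<dots> \<le> (1 + y) powr s"
    using powr_above_tangent[of 1 "1 + y" s] y r3 by (simp add: s_def)
  finally have "(real j / 4) ^ 4 \<le> ((1 + y) powr s) ^ 4" by (intro power_mono) auto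
  also have "((1 + y) powr s) ^ 4 = (1 + y) powr (r + 1)"
  proof -
    have "4 * s = r + 1" by (simp add: s_def)
    then show ?thesis using y by (simp add: powr_power mult.commute)
  qed
  finally have "(real j / 4) ^ 4 \<le> (1 + y) powr (r + 1)" .
  then have "(1 + y) powr (- (r + 1)) \<le> inverse ((real j / 4) ^ 4)"
    unfolding powr_minus using j by (intro le_imp_inverse_le) auto
  also have "\<dots> = 256 / real j ^ 4" by (simp add: field_simps)
  finally have 2: "(1 + y) powr (- (r + 1)) \<le> 256 / real j ^ 4" .
  have "(1 + real j / real n) powr (- (r + 1)) = (1 + 1 / real n) powr (- (r + 1)) * (1 + y) powr (- (r + 1))"
    unfolding fac using y by (intro powr_mult)
  also have "\<dots> \<le> (3 * exp (- r / real n)) * (256 / real j ^ 4)"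
    by (intro mult_mono 1 2) auto
  finally show ?thesis by simp
qed

text \<open>The term j = 0 is 0 because \<open>inverse 0 = 0\<close>, so the value is 768 pi^2/6 =
  128 pi^2.\<close>

definition coefficient_const :: real where
  "coefficient_const = 768 * (\<Sum>j. inverse (real j ^ 2))"

lemma coefficient_const_nonneg: "0 \<le> coefficient_const"
  unfolding coefficient_const_def
  by (intro mult_nonneg_nonneg suminf_nonneg inverse_power_summable) auto

text \<open>The factor (j/n)^2 from \<open>powr_sub_exp_bounds\<close> and the decay j^(-4) from
  \<open>coefficient_bound\<close> leave a multiple of j^(-2), with r n^(-2) exp(-r/n) in
  front.\<close>

lemma coefficient_sum_bound:
  fixes n :: nat and r :: real
  assumes n: "real n + 1 \<le> r" "r \<le> (real n)\<^sup>2" "n \<ge> 2"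
  shows "(\<Sum>j. \<bar>(1 + real j / real n) powr (- r) - exp (- r / real n) ^ j\<bar>) \<le>
    coefficient_const * (r / (real n)\<^sup>2 * exp (- r / real n))"
proof -
  define A where "A = 768 * (r / (real n)\<^sup>2 * exp (- r / real n))"
  have s: "summable (\<lambda>j. A * inverse (real j ^ 2))"
    by (intro summable_mult inverse_power_summable) auto
  have b: "norm (\<bar>(1 + real j / real n) powr (- r) - exp (- r / real n) ^ j\<bar>) \<le> A * inverse (real j ^ 2)" for j
  \<comment> \<open>At j = 0 both coefficients are 1, and the majorant is 0 by the convention
    \<open>inverse 0 = 0\<close>.\<close>
  proof (cases "j = 0")
    case False
    have e: "exp (- r / real n) ^ j = exp (- r * (real j / real n))"
      by (simp add: exp_of_nat_mult[symmetric] field_simps)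
    note p = powr_sub_exp_bounds[of "real j / real n" r]
    have r0: "r \<ge> 0" using n(1) by linarith
    have "norm (\<bar>(1 + real j / real n) powr (- r) - exp (- r / real n) ^ j\<bar>) =
        (1 + real j / real n) powr (- r) - exp (- r / real n) ^ j"
      unfolding e using p(1) r0 by simp
    also have "\<dots> \<le> r * (real j / real n)\<^sup>2 * (1 + real j / real n) powr (- (r + 1))"
      unfolding e using p(2) r0 by simp
    also have "\<dots> \<le> r * (real j / real n)\<^sup>2 * (768 * exp (- r / real n) / real j ^ 4)"
      using False r0 by (intro mult_left_mono coefficient_bound n) auto
    also have "\<dots> = A * inverse (real j ^ 2)"
      using False n(3) by (simp add: A_def field_simps power_divide)
    finally show ?thesis .
  qed simp
  have "(\<Sum>j. \<bar>(1 + real j / real n) powr (- r) - exp (- r / real n) ^ j\<bar>) \<le> (\<Sum>j. A * inverse (real j ^ 2))"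
    using b by (intro suminf_le s summable_comparison_test'[OF s]) auto
  also have "\<dots> = A * (\<Sum>j. inverse (real j ^ 2))"
    by (intro suminf_mult inverse_power_summable) auto
  finally show ?thesis unfolding A_def coefficient_const_def by (simp add: mult_ac)
qed

section \<open>Parseval's identity for the geometric kernel\<close>

text \<open>The complex envelope of the geometric kernel: it multiplies the wave of frequency n, its
  modulus being the local amplitude and its argument a local phase shift.\<close>

definition geometric_amplitude :: "real \<Rightarrow> real \<Rightarrow> complex" where
  "geometric_amplitude q t = 1 / (1 - of_real q * cis t)"

lemma one_minus_cis_nonzero:
  assumes "0 \<le> q" "q < 1"
  shows "1 - complex_of_real q * cis t \<noteq> 0"
proof
  assume "1 - complex_of_real q * cis t = 0"
  then have "norm (complex_of_real q * cis t) = 1" by simp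
  then show False using assms by (simp add: norm_mult)
qed

lemma trig_kernel_geometric:
  assumes q: "0 \<le> q" "q < 1"
  shows "trig_kernel (\<lambda>j. q ^ j) n b t = Re (cis (real n * t - b) * geometric_amplitude q t)"
proof -
  define z where "z = complex_of_real q * cis t"
  have "norm z < 1" using q by (simp add: z_def norm_mult)
  then have "(\<lambda>j. cis (real n * t - b) * z ^ j) sums (cis (real n * t - b) * geometric_amplitude q t)"
    unfolding geometric_amplitude_def z_def[symmetric] by (intro sums_mult geometric_sums)
  then have "(\<lambda>j. Re (cis (real n * t - b) * z ^ j)) sums Re (cis (real n * t - b) * geometric_amplitude q t)"
    by (rule sums_Re)
  moreover have "Re (cis (real n * t - b) * z ^ j) = q ^ j * cos (real (j + n) * t - b)" for j
  proof -
    have "z ^ j = of_real (q ^ j) * cis (real j * t)"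
      unfolding z_def power_mult_distrib Complex.DeMoivre by simp
    then have "cis (real n * t - b) * z ^ j = of_real (q ^ j) * (cis (real n * t - b) * cis (real j * t))"
      by (simp only: mult.left_commute)
    also have "cis (real n * t - b) * cis (real j * t) = cis (real (j + n) * t - b)"
      unfolding cis_mult by (simp add: algebra_simps)
    finally show ?thesis by simp
  qed
  ultimately show ?thesis
    unfolding trig_kernel_def by (simp add: sums_iff)
qed

text \<open>For fixed t the phase b occurs only inside one cosine. Integrating the p-th power over b
  therefore separates into the amplitude to the power p and the p-integral of the cosine.\<close>

lemma trig_kernel_geometric_polar:
  assumes q: "0 \<le> q" "q < 1"
  shows "trig_kernel (\<lambda>j. q ^ j) n b t =
    cmod (geometric_amplitude q t) * cos (real n * t - b + Arg (geometric_amplitude q t))"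
proof -
  have "trig_kernel (\<lambda>j. q ^ j) n b t = Re (cis (real n * t - b) * geometric_amplitude q t)"
    by (rule trig_kernel_geometric[OF q])
  also have "geometric_amplitude q t = cmod (geometric_amplitude q t) * cis (Arg (geometric_amplitude q t))"
    using rcis_cmod_Arg[of "geometric_amplitude q t"] by (simp add: rcis_def)
  finally show ?thesis
    by (simp only: mult.left_commute[of "cis (real n * t - b)"] cis_mult) simp
qed

text \<open>Writing the p-th power as the squared modulus of (1 - z)^(-p/2) makes Parseval's
  identity applicable for every real p.\<close>

lemma cmod_geometric_amplitude_powr:
  assumes q: "0 \<le> q" "q < 1"
  shows "cmod (geometric_amplitude q t) powr p =
    (cmod ((1 - of_real q * cis t) powr of_real (- p / 2)))\<^sup>2"
proof -
  let ?z = "1 - complex_of_real q * cis t"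
  note nz = one_minus_cis_nonzero[OF q, of t]
  have "cmod (?z powr of_real (- p / 2)) = exp (- p / 2 * ln (cmod ?z))"
    using nz by (simp add: powr_def norm_exp_eq_Re)
  then have "(cmod (?z powr of_real (- p / 2)))\<^sup>2 = exp (- p * ln (cmod ?z))"
    by (simp add: power2_eq_square exp_add[symmetric])
  also have "\<dots> = cmod (geometric_amplitude q t) powr p"
    using nz by (simp add: geometric_amplitude_def norm_divide powr_def ln_div)
  finally show ?thesis by simp
qed

text \<open>The signs in (-a choose k) and in (-z)^k cancel, which leaves rising factorials; these
  are nonnegative for a \<ge> 0.\<close>

lemma binomial_series_sums:
  assumes "cmod z < 1"
  shows "(\<lambda>k. of_real (pochhammer a k / fact k) * z ^ k) sums ((1 - z) powr of_real (- a))"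
proof -
  have "(\<lambda>k. (of_real (- a) gchoose k) * (- z) ^ k) sums ((1 + - z) powr of_real (- a))"
    using assms by (intro gen_binomial_complex) simp
  moreover have "(of_real (- a) gchoose k) * (- z) ^ k = of_real (pochhammer a k / fact k) * z ^ k" for k
  proof -
    have "(- z) ^ k = (- 1) ^ k * z ^ k" by (rule power_minus)
    moreover have "(- 1) ^ k * (- 1) ^ k = (1 :: complex)" by (simp flip: power_mult_distrib)
    ultimately show ?thesis
      by (simp add: gbinomial_pochhammer pochhammer_of_real mult_ac)
  qed
  ultimately show ?thesis by simp
qed

text \<open>Let F = u + i v be the sum of c_k exp(ikt), and W_k the real part of exp(-ikt) F. Then
  |F|^2 is the sum of c_k W_k, and W_k has integral 2 pi c_k. Two term-by-term integrations of
  simple series thus replace a double series.\<close>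

lemma trig_kernel_parseval:
  assumes c: "summable (\<lambda>k. \<bar>c k\<bar>)"
  shows "integral {-pi..pi} (\<lambda>t. (trig_kernel c 0 0 t)\<^sup>2 + (trig_kernel c 0 (pi / 2) t)\<^sup>2) =
    2 * pi * (\<Sum>k. (c k)\<^sup>2)"
proof -
  let ?u = "trig_kernel c 0 0" and ?v = "trig_kernel c 0 (pi / 2)"
  define C where "C = (\<Sum>k. \<bar>c k\<bar>)"
  have u: "(\<lambda>m. c m * cos (real m * t)) sums ?u t" for t
    using summable_sums[OF summable_trig_kernel[OF c, of 0 t 0]] by (simp add: trig_kernel_def)
  have cs: "cos (x - pi / 2) = sin x" for x :: real by (simp add: cos_diff)
  have v: "(\<lambda>m. c m * sin (real m * t)) sums ?v t" for t
    using summable_sums[OF summable_trig_kernel[OF c, of 0 t "pi / 2"]] by (simp add: trig_kernel_def cs)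
  have cont: "continuous_on S ?u" "continuous_on S ?v" for S
    by (rule continuous_trig_kernel[OF c])+
  define W where "W k t = cos (real k * t) * ?u t + sin (real k * t) * ?v t" for k t
  have Wc: "continuous_on S (W k)" for S k
    unfolding W_def by (intro continuous_intros cont)
  have W: "(\<lambda>m. c m * cos (of_int (int m - int k) * t + 0)) sums W k t" for k t
  proof -
    have "(\<lambda>m. cos (real k * t) * (c m * cos (real m * t)) + sin (real k * t) * (c m * sin (real m * t))) sums W k t"
      unfolding W_def by (intro sums_add sums_mult u v)
    moreover have "cos (real k * t) * (c m * cos (real m * t)) + sin (real k * t) * (c m * sin (real m * t)) =
        c m * cos (of_int (int m - int k) * t + 0)" for m
      using cos_diff[of "real m * t" "real k * t"] by (simp add: algebra_simps)
    ultimately show ?thesis by simp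
  qed
  have one: "integrable period_measure (\<lambda>_. 1::real)"
    by (intro period_integrable_continuous continuous_intros)
  have WC: "\<bar>W k t\<bar> \<le> C" for k t
  proof -
    have "norm (\<Sum>m. c m * cos (of_int (int m - int k) * t + 0)) \<le> C"
      unfolding C_def by (rule norm_suminf_le[OF _ c]) (simp add: trig_kernel_term_le)
    then show ?thesis using W[of k t] by (simp add: sums_iff)
  qed
  have intW: "(\<integral>t. W k t \<partial>period_measure) = 2 * pi * c k" for k
  proof -
    have "(\<lambda>m. \<integral>t. c m * cos (of_int (int m - int k) * t + 0) \<partial>period_measure) sums
        (\<integral>t. (\<Sum>m. c m * cos (of_int (int m - int k) * t + 0)) \<partial>period_measure)"
    proof (rule sums_integral_dominated(1)[OF one _ _ c])
      show "(\<lambda>t. c m * cos (of_int (int m - int k) * t + 0)) \<in> borel_measurable period_measure" for m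
        by (intro period_measurable_continuous continuous_intros)
    qed (simp add: trig_kernel_term_le)
    moreover have "(\<Sum>m. c m * cos (of_int (int m - int k) * t + 0)) = W k t" for t
      using W[of k t] by (simp add: sums_iff)
    moreover have "(\<integral>t. c m * cos (of_int (int m - int k) * t + 0) \<partial>period_measure) =
        (if m = k then 2 * pi * c m else 0)" for m
      unfolding integral_mult_right_zero integral_cos_phase by simp
    ultimately show ?thesis
      using sums_single[of k "\<lambda>m. 2 * pi * c m"] sums_unique2 by simp
  qed
  have "(\<lambda>k. c k * W k t) sums ((?u t)\<^sup>2 + (?v t)\<^sup>2)" for t
  proof -
    have "(\<lambda>k. ?u t * (c k * cos (real k * t)) + ?v t * (c k * sin (real k * t))) sums (?u t * ?u t + ?v t * ?v t)"
      by (intro sums_add sums_mult u v)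
    then show ?thesis by (simp add: W_def power2_eq_square algebra_simps)
  qed
  then have sq: "(\<Sum>k. c k * W k t) = (?u t)\<^sup>2 + (?v t)\<^sup>2" for t by (simp add: sums_iff)
  have "(\<lambda>k. \<integral>t. c k * W k t \<partial>period_measure) sums (\<integral>t. (\<Sum>k. c k * W k t) \<partial>period_measure)"
  proof (rule sums_integral_dominated(1)[OF _ _ _ c])
    show "integrable period_measure (\<lambda>_. C)"
      by (intro period_integrable_continuous continuous_intros)
    show "(\<lambda>t. c k * W k t) \<in> borel_measurable period_measure" for k
      by (intro period_measurable_continuous continuous_intros Wc)
    show "norm (c k * W k t) \<le> \<bar>c k\<bar> * C" for k t
      using WC by (simp add: abs_mult mult_left_mono)
  qed
  then have "(\<integral>t. (?u t)\<^sup>2 + (?v t)\<^sup>2 \<partial>period_measure) = (\<Sum>k. 2 * pi * (c k)\<^sup>2)"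
    unfolding sq integral_mult_right_zero intW by (simp add: sums_iff power2_eq_square mult_ac)
  also have "\<dots> = 2 * pi * (\<Sum>k. (c k)\<^sup>2)"
  proof (rule suminf_mult)
    have "norm ((c k)\<^sup>2) \<le> \<bar>c k\<bar> * C" for k
      using sum_le_suminf[OF c, of "{k}"] unfolding C_def power2_eq_square real_norm_def abs_mult
      by (intro mult_left_mono) auto
    then show "summable (\<lambda>k. (c k)\<^sup>2)"
      by (intro summable_comparison_test'[OF summable_mult2[OF c]])
  qed
  finally show ?thesis
    by (subst (asm) period_integral_continuous) (intro continuous_intros cont)+
qed

text \<open>The squares of the binomial coefficients (p/2)_k q^k / k! are exactly the hypergeometric
  terms at q^2, one factor k! being read as (1)_k.\<close>

lemma integral_geometric_amplitude:
  assumes q: "0 \<le> q" "q < 1" and p: "p \<ge> 0"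
  shows "integral {-pi..pi} (\<lambda>t. cmod (geometric_amplitude q t) powr p) =
    2 * pi * gauss_hypergeo (p / 2) (p / 2) 1 (q\<^sup>2)"
proof -
  define c where "c k = pochhammer (p / 2) k / fact k * q ^ k" for k
  have c0: "c k \<ge> 0" for k
    unfolding c_def using q p pochhammer_nonneg[of "p / 2" k]
    by (cases "p = 0") (auto simp: pochhammer_0_left)
  have S: "(\<lambda>k. of_real (c k) * cis (real k * t)) sums ((1 - of_real q * cis t) powr of_real (- p / 2))" for t
  proof -
    have "cmod (of_real q * cis t) < 1" using q by (simp add: norm_mult)
    from binomial_series_sums[OF this, of "p / 2"] show ?thesis
      unfolding power_mult_distrib Complex.DeMoivre by (simp add: c_def mult.assoc)
  qed
  \<comment> \<open>The coefficients are nonnegative, so convergence at t = 0 is already absolute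
    summability.\<close>
  have "(\<lambda>k. Re (of_real (c k) * cis (real k * 0))) sums Re ((1 - of_real q * cis 0) powr of_real (- p / 2))"
    by (intro sums_Re S)
  then have c: "summable (\<lambda>k. \<bar>c k\<bar>)" using c0 by (simp add: sums_iff)
  have "cmod (geometric_amplitude q t) powr p = (trig_kernel c 0 0 t)\<^sup>2 + (trig_kernel c 0 (pi / 2) t)\<^sup>2" for t
  proof -
    let ?s = "(1 - of_real q * cis t) powr of_real (- p / 2)"
    have cs: "cos (x - pi / 2) = sin x" for x :: real by (simp add: cos_diff)
    have "Re ?s = trig_kernel c 0 0 t" "Im ?s = trig_kernel c 0 (pi / 2) t"
      using sums_Re[OF S[of t]] sums_Im[OF S[of t]] by (simp_all add: trig_kernel_def cs sums_iff)
    then show ?thesis unfolding cmod_geometric_amplitude_powr[OF q] cmod_power2 by simp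
  qed
  then have "integral {-pi..pi} (\<lambda>t. cmod (geometric_amplitude q t) powr p) = 2 * pi * (\<Sum>k. (c k)\<^sup>2)"
    by (simp add: trig_kernel_parseval[OF c])
  also have "(\<Sum>k. (c k)\<^sup>2) = gauss_hypergeo (p / 2) (p / 2) 1 (q\<^sup>2)"
    unfolding gauss_hypergeo_def
  proof (rule suminf_cong)
    fix k
    show "(c k)\<^sup>2 = pochhammer (p / 2) k * pochhammer (p / 2) k / pochhammer 1 k * ((q\<^sup>2) ^ k / fact k)"
      by (simp add: c_def power2_eq_square pochhammer_fact[symmetric] power_mult_distrib)
  qed
  finally show ?thesis .
qed

section \<open>The p-norm of the geometric kernel\<close>

lemma lp_periodic_shift:
  assumes "continuous_on UNIV f" and "\<And>t. f (t + 2 * pi) = f t" and "p \<ge> 1"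
  shows "lp p (\<lambda>t. f (t - s)) = lp p f"
  unfolding lp_def using integral_periodic_shift[of "\<lambda>t. \<bar>f t\<bar> powr p" s] assms(2)
    continuous_abs_powr[OF assms(1,3)] by simp

lemma summable_geometric_coefficients:
  fixes q :: real
  assumes "0 \<le> q" "q \<le> 1 / 2"
  shows "summable (\<lambda>j. \<bar>q ^ j\<bar>)" and "summable (\<lambda>j. real j * \<bar>q ^ j\<bar>)"
    and "(\<Sum>j. real j * \<bar>q ^ j\<bar>) \<le> 4 * q"
proof -
  note s = sums_mult_power[of q]
  have q: "q < 1" "\<bar>q ^ j\<bar> = q ^ j" for j using assms by auto
  show "summable (\<lambda>j. \<bar>q ^ j\<bar>)" using q assms by simp
  show "summable (\<lambda>j. real j * \<bar>q ^ j\<bar>)" using s q assms by (simp add: sums_iff)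
  have "1 / 4 \<le> (1 - q)\<^sup>2"
    using power_mono[of "1 / 2" "1 - q" 2] assms by (simp add: power2_eq_square)
  then have "q / (1 - q)\<^sup>2 \<le> q / (1 / 4)"
    using assms by (intro divide_left_mono) auto
  then show "(\<Sum>j. real j * \<bar>q ^ j\<bar>) \<le> 4 * q" using s q assms by (simp add: sums_iff)
qed

text \<open>Changing the phase of a geometric kernel by \<open>n s\<close> amounts to a translation by \<open>s\<close>, up to
  \<open>4 q \<bar>s\<bar>\<close>. So all phases give nearly the same norm, and the power mean of these norms over the
  phase is given exactly by Fubini and Parseval.\<close>

lemma lp_geometric_kernel:
  fixes q b p :: real and n :: nat
  assumes q: "0 \<le> q" "q \<le> 1 / 2" and n: "n \<ge> 1" and p: "p \<ge> 1"
  defines "m \<equiv> lp p cos * gauss_hypergeo (p / 2) (p / 2) 1 (q\<^sup>2) powr (1 / p)"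
  shows "\<bar>lp p (trig_kernel (\<lambda>j. q ^ j) n b) - m\<bar> \<le> 8 * pi\<^sup>2 * q / real n"
proof -
  define P where "P \<tau> = trig_kernel (\<lambda>j. q ^ j) n \<tau>" for \<tau>
  define X where "X = lp p (P b)"
  define d where "d = 8 * pi\<^sup>2 * q / real n"
  define F where "F = gauss_hypergeo (p / 2) (p / 2) 1 (q\<^sup>2)"
  let ?w = "\<lambda>t. cmod (geometric_amplitude q t)"
  have q1: "q < 1" using q by simp
  note s = summable_geometric_coefficients[OF q]
  have d0: "d \<ge> 0" using q by (simp add: d_def)
  have Pc: "continuous_on S (P \<tau>)" for S \<tau>
    unfolding P_def by (rule continuous_trig_kernel[OF s(1)])
  have near: "lp p (P \<tau>) \<le> X + d" "X \<le> lp p (P \<tau>) + d" if \<tau>: "\<tau> \<in> {b - pi..b + pi}" for \<tau>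
  proof -
    \<comment> \<open>A phase within pi of \<open>b\<close> needs a translation by at most pi/n. The
      kernels then differ by at most 4 q pi/n, and \<open>lp_perturb\<close> multiplies this by 2
      pi; this is the origin of \<open>d\<close>.\<close>
    define h where "h = (\<tau> - b) / real n"
    have bh: "b + real n * h = \<tau>" using n by (simp add: h_def)
    have h: "\<bar>h\<bar> \<le> pi / real n" using \<tau> n by (auto simp: h_def abs_le_iff field_simps)
    have close: "\<bar>P b (t - h) - P \<tau> t\<bar> \<le> pi / real n * (4 * q)" for t
    proof -
      have "\<bar>P b (t - h) - P \<tau> t\<bar> \<le> \<bar>h\<bar> * (\<Sum>j. real j * \<bar>q ^ j\<bar>)"
        using trig_kernel_shift[OF s(1,2), of n b t h] unfolding bh P_def .
      also have "\<dots> \<le> pi / real n * (4 * q)"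
        using s(2,3) h by (intro mult_mono suminf_nonneg) auto
      finally show ?thesis .
    qed
    have e: "2 * pi * (pi / real n * (4 * q)) = d"
      by (simp add: d_def power2_eq_square)
    have Ph: "continuous_on {-pi..pi} (\<lambda>t. P b (t - h))"
      by (intro continuous_on_compose2[OF Pc[of UNIV b]] continuous_intros) auto
    have Xh: "lp p (\<lambda>t. P b (t - h)) = X"
      unfolding X_def using p by (intro lp_periodic_shift Pc) (simp_all add: P_def trig_kernel_periodic)
    show "lp p (P \<tau>) \<le> X + d"
      using lp_perturb[OF Pc Ph p, of \<tau> "pi / real n * (4 * q)"] close unfolding Xh e
      by (simp add: abs_minus_commute)
    show "X \<le> lp p (P \<tau>) + d"
      using lp_perturb[OF Ph Pc p, of \<tau> "pi / real n * (4 * q)"] close unfolding Xh e by simp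
  qed
  have FI: "integral {-pi..pi} (\<lambda>t. ?w t powr p) = 2 * pi * F"
    unfolding F_def using p by (intro integral_geometric_amplitude q q1) simp
  have gc: "continuous_on S (geometric_amplitude q)" for S
    unfolding geometric_amplitude_def[abs_def]
    using one_minus_cis_nonzero[OF q(1) q1] by (intro continuous_intros) auto
  have "0 \<le> integral {-pi..pi} (\<lambda>t. ?w t powr p)"
    using continuous_abs_powr[OF continuous_on_norm[OF gc] p]
    by (intro integral_nonneg integrable_continuous_real) simp_all
  then have F0: "F \<ge> 0" unfolding FI zero_le_mult_iff using pi_gt_zero by linarith
  have mp: "m powr p = lp p cos powr p * F"
    using p F0 lp_nonneg[of p cos] by (simp add: m_def F_def[symmetric] powr_mult powr_powr)
  have m0: "m \<ge> 0" unfolding m_def by (simp add: lp_nonneg)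
  \<comment> \<open>Joint continuity in phase and argument, read off the closed form, is what allows
    exchanging the two integrals.\<close>
  have joint: "continuous_on S (\<lambda>(\<tau>, t). \<bar>P \<tau> t\<bar> powr p)" for S
  proof -
    have "continuous_on S (\<lambda>x. Re (cis (real n * snd x - fst x) * geometric_amplitude q (snd x)))"
      by (intro continuous_intros continuous_on_compose2[OF gc[of UNIV]]) auto
    then show ?thesis
      unfolding P_def trig_kernel_geometric[OF q(1) q1] case_prod_beta
      by (rule continuous_abs_powr[OF _ p])
  qed
  have param: "(\<lambda>\<tau>. lp p (P \<tau>) powr p) integrable_on {b - pi..b + pi}"
    unfolding lp_powr[OF p]
    using integral_continuous_on_param[of "{b - pi..b + pi}" "-pi" pi "\<lambda>\<tau> t. \<bar>P \<tau> t\<bar> powr p"] joint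
    by (intro integrable_continuous_real) simp
  have cosI: "integral {b - pi..b + pi} (\<lambda>\<tau>. \<bar>cos (\<omega> - \<tau>)\<bar> powr p) = lp p cos powr p" for \<omega>
  proof -
    have "((\<lambda>\<tau>. \<bar>cos \<tau>\<bar> powr p) has_integral (lp p cos powr p)) {-pi..pi}"
      unfolding lp_powr[OF p]
      by (intro integrable_integral integrable_continuous_real continuous_abs_powr continuous_intros p)
    then have "((\<lambda>\<tau>. \<bar>cos (\<omega> - \<tau>)\<bar> powr p) has_integral (lp p cos powr p)) {-pi..pi}"
      by (rule has_integral_periodic_reflect[rotated]) simp
    then have "((\<lambda>\<tau>. \<bar>cos (\<omega> - \<tau>)\<bar> powr p) has_integral (lp p cos powr p)) {b - pi..b - pi + 2 * pi}"
      by (rule has_integral_periodic[rotated]) (simp add: diff_diff_eq[symmetric] cos_diff)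
    then show ?thesis by (intro integral_unique) (simp add: algebra_simps)
  qed
  have "integral {b - pi..b + pi} (\<lambda>\<tau>. lp p (P \<tau>) powr p) =
      integral {-pi..pi} (\<lambda>t. integral {b - pi..b + pi} (\<lambda>\<tau>. \<bar>P \<tau> t\<bar> powr p))"
    unfolding lp_powr[OF p]
    using integral_swap_continuous[of "b - pi" "-pi" "b + pi" pi "\<lambda>\<tau> t. \<bar>P \<tau> t\<bar> powr p"] joint
    by simp
  also have "\<dots> = integral {-pi..pi} (\<lambda>t. ?w t powr p * lp p cos powr p)"
  proof (rule integral_cong)
    fix t
    have "\<bar>P \<tau> t\<bar> powr p = ?w t powr p * \<bar>cos ((real n * t + Arg (geometric_amplitude q t)) - \<tau>)\<bar> powr p" for \<tau>
      unfolding P_def trig_kernel_geometric_polar[OF q(1) q1] abs_mult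
      by (simp add: powr_mult algebra_simps)
    then show "integral {b - pi..b + pi} (\<lambda>\<tau>. \<bar>P \<tau> t\<bar> powr p) = ?w t powr p * lp p cos powr p"
      by (simp only: integral_mult_right cosI)
  qed
  also have "\<dots> = 2 * pi * m powr p"
    by (simp only: integral_mult_left FI mp) simp
  finally have J: "integral {b - pi..b + pi} (\<lambda>\<tau>. lp p (P \<tau>) powr p) = 2 * pi * m powr p" .
  have const: "((\<lambda>_. c) has_integral 2 * pi * c) {b - pi..b + pi}" for c :: real
    using has_integral_const_real[of c "b - pi" "b + pi"] by simp
  \<comment> \<open>By \<open>J\<close>, \<open>m\<close> is the p-th power mean over the phases of
    the norms \<open>lp p (P \<tau>)\<close>. All of these lie within \<open>d\<close> of
    \<open>X\<close>, hence so does their mean.\<close>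
  have "2 * pi * m powr p \<le> 2 * pi * (X + d) powr p"
    unfolding J[symmetric]
  proof (rule has_integral_le[OF integrable_integral[OF param] const])
    fix \<tau> assume "\<tau> \<in> {b - pi..b + pi}"
    then show "lp p (P \<tau>) powr p \<le> (X + d) powr p"
      using near(1) p by (intro powr_mono2 lp_nonneg) auto
  qed
  then have "m powr p \<le> (X + d) powr p" by simp
  then have upper: "m \<le> X + d"
    by (rule powr_le_powrD[OF _ m0 _ p]) (use d0 lp_nonneg[of p] X_def in simp)
  have lower: "X - d \<le> m"
  \<comment> \<open>Powers are compared only for a nonnegative base; if X < d the claim follows from
    m \<ge> 0.\<close>
  proof (cases "X \<ge> d")
    case True
    have "2 * pi * (X - d) powr p \<le> 2 * pi * m powr p"
      unfolding J[symmetric]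
    proof (rule has_integral_le[OF const integrable_integral[OF param]])
      fix \<tau> assume "\<tau> \<in> {b - pi..b + pi}"
      then show "(X - d) powr p \<le> lp p (P \<tau>) powr p"
        using near(2)[of \<tau>] True p by (intro powr_mono2) auto
    qed
    then have "(X - d) powr p \<le> m powr p" by simp
    then show ?thesis
      by (rule powr_le_powrD[OF _ _ m0 p]) (use True in simp)
  qed (use m0 in linarith)
  show ?thesis using upper lower unfolding X_def d_def P_def by linarith
qed

section \<open>Test functions\<close>

lemma B01I:
  assumes "\<And>t. \<phi> (t + 2 * pi) = \<phi> t" and m: "\<phi> \<in> borel_measurable lebesgue"
    and i: "integrable period_measure \<phi>" and "(\<integral>t. \<bar>\<phi> t\<bar> \<partial>period_measure) \<le> 1"
    and "(\<integral>t. \<phi> t \<partial>period_measure) = 0"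
  shows "\<phi> \<in> B01"
proof -
  have "(\<integral>\<^sup>+t. ennreal \<bar>\<phi> t\<bar> \<partial>period_measure) = ennreal (\<integral>t. \<bar>\<phi> t\<bar> \<partial>period_measure)"
    using i by (intro nn_integral_eq_integral) auto
  then have "Lp_norm 1 \<phi> = ereal (\<integral>t. \<bar>\<phi> t\<bar> \<partial>period_measure)"
    by (simp add: Lp_norm_def Let_def)
  then show ?thesis using assms by (auto simp: B01_def Lp_space_def)
qed

text \<open>A condition on cosines makes the function periodic by construction. For 0 < e \<le> pi
  it agrees on the basic period with the indicator of [-e, e], normalised to mass 1.\<close>

definition window :: "real \<Rightarrow> real \<Rightarrow> real" where
  "window e u = (if cos e \<le> cos u then 1 / (2 * e) else 0)"

lemma window_periodic: "window e (u + 2 * pi) = window e u"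
  by (simp add: window_def)

lemma window_nonneg: "0 < e \<Longrightarrow> 0 \<le> window e u"
  by (simp add: window_def)

lemma window_eq:
  assumes "0 < e" "e \<le> pi" "u \<in> {-pi..pi}"
  shows "window e u = (if u \<in> {-e..e} then 1 / (2 * e) else 0)"
proof -
  have "cos e \<le> cos \<bar>u\<bar> \<longleftrightarrow> \<bar>u\<bar> \<le> e"
    using assms by (intro cos_mono_le_eq) auto
  then show ?thesis by (auto simp: window_def abs_le_iff)
qed

lemma has_integral_window:
  assumes "0 < e" "e \<le> pi"
  shows "(window e has_integral 1) {-pi..pi}"
proof -
  have "((\<lambda>u. 1 / (2 * e)) has_integral 1) {-e..e}"
    using has_integral_const_real[of "1 / (2 * e)" "-e" e] assms by simp
  then have "((\<lambda>u. if u \<in> {-e..e} then 1 / (2 * e) else 0) has_integral 1) {-pi..pi}"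
    using assms by (subst has_integral_restrict) auto
  then show ?thesis
    by (rule has_integral_eq[rotated]) (use window_eq[OF assms] in auto)
qed

lemma window_shift:
  assumes e: "0 < e" "e \<le> pi"
  shows "(\<lambda>u. window e (u - h)) absolutely_integrable_on {-pi..pi}"
    and "((\<lambda>u. window e (u - h)) has_integral 1) {-pi..pi}"
proof -
  show i: "((\<lambda>u. window e (u - h)) has_integral 1) {-pi..pi}"
    by (intro has_integral_periodic_shift window_periodic has_integral_window e)
  then show "(\<lambda>u. window e (u - h)) absolutely_integrable_on {-pi..pi}"
    using window_nonneg[OF e(1)] by (intro nonnegative_absolutely_integrable_1) auto
qed

lemma window_average:
  fixes w :: "real \<Rightarrow> real"
  assumes e: "0 < e" "e \<le> pi" and w: "continuous_on UNIV w" "\<And>t. w (t + 2 * pi) = w t"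
    and \<omega>: "\<And>u. \<bar>u\<bar> \<le> e \<Longrightarrow> \<bar>w (u + h) - w h\<bar> \<le> \<omega>"
  obtains i where "((\<lambda>u. window e (u - h) * w u) has_integral i) {-pi..pi}" and "\<bar>i - w h\<bar> \<le> \<omega>"
proof -
  define H where "H u = window e u * w (u + h)" for u
  have Hp: "H (u + 2 * pi) = H u" for u
    using w(2)[of "u + h"] window_periodic[of e u] by (simp add: H_def algebra_simps)
  have "continuous_on {-pi..pi} (\<lambda>u. w (u + h))"
    by (intro continuous_on_compose2[OF w(1)] continuous_intros) auto
  from absolutely_integrable_mult_continuous[OF _ this, of "window e"] window_shift(1)[OF e, of 0]
  have "H absolutely_integrable_on {-pi..pi}" by (simp add: H_def[abs_def])
  then obtain i where i: "(H has_integral i) {-pi..pi}"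
    by (auto simp: absolutely_integrable_on_def integrable_on_def)
  note W = has_integral_window[OF e]
  have b: "(w h - \<omega>) * window e u \<le> H u \<and> H u \<le> (w h + \<omega>) * window e u" if "u \<in> {-pi..pi}" for u
  proof (cases "u \<in> {-e..e}")
    case True
    then have "\<bar>w (u + h) - w h\<bar> \<le> \<omega>" by (intro \<omega>) auto
    then have "(w h - \<omega>) * window e u \<le> w (u + h) * window e u"
      "w (u + h) * window e u \<le> (w h + \<omega>) * window e u"
      by (intro mult_right_mono window_nonneg e; linarith)+
    then show ?thesis by (simp add: H_def mult.commute)
  qed (use window_eq[OF e that] in \<open>auto simp: H_def\<close>)
  have "(w h - \<omega>) * 1 \<le> i"
    by (rule has_integral_le[OF has_integral_mult_right[OF W] i]) (use b in blast)
  moreover have "i \<le> (w h + \<omega>) * 1"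
    by (rule has_integral_le[OF i has_integral_mult_right[OF W]]) (use b in blast)
  ultimately have "\<bar>i - w h\<bar> \<le> \<omega>" by (simp add: abs_le_iff)
  moreover have "((\<lambda>u. window e (u - h) * w u) has_integral i) {-pi..pi}"
    using has_integral_periodic_shift[of H i h, OF Hp i] by (simp add: H_def)
  ultimately show ?thesis using that by blast
qed

text \<open>The function is half the difference of two windows, at 0 and at h. The equal masses
  cancel, and the triangle inequality bounds the norm by 1 even if the windows overlap. Each window
  averages \<open>K\<close> up to its oscillation \<omega>, and the two halves of \<omega> add
  up.\<close>

lemma B01_two_point_test_function:
  fixes K :: "real \<Rightarrow> real"
  assumes e: "0 < e" "e \<le> pi" and K: "continuous_on UNIV K" "\<And>t. K (t + 2 * pi) = K t"
    and \<omega>: "\<And>t u. \<bar>u\<bar> \<le> e \<Longrightarrow> \<bar>K (t - u) - K t\<bar> \<le> \<omega>"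
  obtains \<phi> where "\<phi> \<in> B01"
    and "\<And>x. \<bar>(\<integral>u. \<phi> u * K (x - u) \<partial>period_measure) - (K x - K (x - h)) / 2\<bar> \<le> \<omega>"
proof
  define \<phi> where "\<phi> u = (window e (u - 0) - window e (u - h)) / 2" for u
  have "(\<lambda>u. (1 / 2) *\<^sub>R (window e (u - 0) - window e (u - h))) absolutely_integrable_on {-pi..pi}"
    using window_shift(1)[OF e, of 0] window_shift(1)[OF e, of h] by (intro set_integrable_scaleR_right set_integral_diff(1)) auto
  then have abs: "\<phi> absolutely_integrable_on {-pi..pi}" by (simp add: \<phi>_def[abs_def])
  then have int: "integrable period_measure \<phi>"
    by (rule absolutely_integrable_imp_integrable) simp
  show "\<phi> \<in> B01"
  proof (rule B01I)
    show "\<phi> (t + 2 * pi) = \<phi> t" for t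
      using window_periodic[of e t] window_periodic[of e "t - h"] by (simp add: \<phi>_def algebra_simps)
    have "\<phi> \<in> borel_measurable borel"
      unfolding \<phi>_def[abs_def] window_def by measurable
    then show "\<phi> \<in> borel_measurable lebesgue" by (simp add: measurable_completion)
    have "((\<lambda>u. (window e (u - 0) - window e (u - h)) / 2) has_integral (1 - 1) / 2) {-pi..pi}"
      by (intro has_integral_divide has_integral_diff window_shift e)
    then have "(\<phi> has_integral 0) {-pi..pi}" by (simp add: \<phi>_def[abs_def])
    then show "(\<integral>t. \<phi> t \<partial>period_measure) = 0"
      using lebesgue_integral_eq_integral[OF int] by (simp add: integral_unique)
    have w2: "((\<lambda>u. (window e (u - 0) + window e (u - h)) / 2) has_integral (1 + 1) / 2) {-pi..pi}"
      by (intro has_integral_divide has_integral_add window_shift e)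
    have "((\<lambda>u. \<bar>\<phi> u\<bar>) has_integral (\<integral>t. \<bar>\<phi> t\<bar> \<partial>period_measure)) {-pi..pi}"
      using int by (intro has_integral_integral_lebesgue_on) auto
    moreover have "\<bar>\<phi> u\<bar> \<le> (window e (u - 0) + window e (u - h)) / 2" for u
      using window_nonneg[OF e(1), of u] window_nonneg[OF e(1), of "u - h"] by (simp add: \<phi>_def)
    ultimately have "(\<integral>t. \<bar>\<phi> t\<bar> \<partial>period_measure) \<le> (1 + 1) / 2"
      by (rule has_integral_le[OF _ w2])
    then show "(\<integral>t. \<bar>\<phi> t\<bar> \<partial>period_measure) \<le> 1" by simp
  qed (rule int)
  fix x
  have Kx: "continuous_on A (\<lambda>u. K (x - u))" for A
    by (intro continuous_on_compose2[OF K(1)] continuous_intros) auto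
  have per: "K (x - (u + 2 * pi)) = K (x - u)" for u
    using K(2)[of "x - u - 2 * pi"] by (simp add: algebra_simps)
  have sh: "\<bar>K (x - (u + k)) - K (x - k)\<bar> \<le> \<omega>" if "\<bar>u\<bar> \<le> e" for u k
    using \<omega>[OF that, of "x - k"] by (simp add: algebra_simps)
  obtain i where i: "((\<lambda>u. window e (u - 0) * K (x - u)) has_integral i) {-pi..pi}" "\<bar>i - K (x - 0)\<bar> \<le> \<omega>"
    by (rule window_average[of e "\<lambda>u. K (x - u)" 0 \<omega>, OF e Kx per sh])
  obtain j where j: "((\<lambda>u. window e (u - h) * K (x - u)) has_integral j) {-pi..pi}" "\<bar>j - K (x - h)\<bar> \<le> \<omega>"
    by (rule window_average[of e "\<lambda>u. K (x - u)" h \<omega>, OF e Kx per sh])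
  have "((\<lambda>u. (window e (u - 0) * K (x - u) - window e (u - h) * K (x - u)) / 2) has_integral (i - j) / 2) {-pi..pi}"
    by (intro has_integral_divide has_integral_diff i j)
  then have "((\<lambda>u. \<phi> u * K (x - u)) has_integral (i - j) / 2) {-pi..pi}"
    by (simp add: \<phi>_def algebra_simps diff_divide_distrib)
  moreover have "integrable period_measure (\<lambda>u. \<phi> u * K (x - u))"
    by (intro absolutely_integrable_imp_integrable absolutely_integrable_mult_continuous abs Kx) simp
  ultimately have "(\<integral>u. \<phi> u * K (x - u) \<partial>period_measure) = (i - j) / 2"
    by (simp add: lebesgue_integral_eq_integral integral_unique)
  then show "\<bar>(\<integral>u. \<phi> u * K (x - u) \<partial>period_measure) - (K x - K (x - h)) / 2\<bar> \<le> \<omega>"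
    using i(2) j(2) by (simp add: abs_le_iff field_simps)
qed

section \<open>The tail of the kernel\<close>

lemma lp_cmult: "c \<ge> 0 \<Longrightarrow> p \<ge> 1 \<Longrightarrow> lp p (\<lambda>t. c * f t) = c * lp p f"
  unfolding lp_def
  by (simp add: abs_mult powr_mult powr_powr integral_nonneg)

text \<open>Dictated by the lower bound for finite p: 8 pi^2 from \<open>lp_geometric_kernel\<close>
  and 2 pi (coefficient_const + 2 pi + 1) from the test function and \<open>lp_perturb\<close>, all
  divided by pi. The other three bounds need less.\<close>

definition main_const :: real where "main_const = 2 * coefficient_const + 12 * pi + 2"

text \<open>The phase \<open>b\<close> stands for \<beta> pi/2 and is left arbitrary, so no constant
  can depend on it. Inside, \<open>\<eta>\<close> is the unit of error: estimates are brought to the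
  form \<open>\<nu>\<close> times a main part plus a multiple of
  \<open>\<nu> * \<eta>\<close>.\<close>

locale weyl_nagy_tail =
  fixes n :: nat and r b :: real
  assumes rn: "real n + 1 \<le> r" "r \<le> (real n)\<^sup>2" and n2: "n \<ge> 2"
begin

definition q :: real where "q = exp (- r / real n)"

definition \<eta> :: real where "\<eta> = r / (real n)\<^sup>2 * q"

definition \<nu> :: real where "\<nu> = real n powr (- r)"

definition K :: "real \<Rightarrow> real" where "K = trig_kernel (\<lambda>j. real (j + n) powr (- r)) n b"

definition P :: "real \<Rightarrow> real" where "P = trig_kernel (\<lambda>j. q ^ j) n b"

lemma r3: "r \<ge> 3" using rn n2 by linarith

lemma \<nu>_pos: "\<nu> > 0" using n2 by (simp add: \<nu>_def)

lemma q: "0 < q" "q \<le> 1 / 2"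
proof -
  have "q \<le> exp (- 1)" using rn n2 by (simp add: q_def field_simps)
  also have "\<dots> = 1 / exp 1" by (simp add: exp_minus field_simps)
  also have "\<dots> \<le> 1 / 2" using exp_ge_add_one_self[of 1] by (intro divide_left_mono) auto
  finally show "q \<le> 1 / 2" .
qed (simp add: q_def)

lemma \<eta>_pos: "\<eta> > 0" using q r3 n2 by (simp add: \<eta>_def)

text \<open>Since r \<ge> n, errors of order q/n, which come from translations, are absorbed by the
  remainder term.\<close>

lemma q_div_n_le: "q / real n \<le> \<eta>"
proof -
  have "real n / (real n)\<^sup>2 \<le> r / (real n)\<^sup>2" using rn by (intro divide_right_mono) auto
  then have "1 / real n * q \<le> r / (real n)\<^sup>2 * q"
    using n2 q by (intro mult_right_mono) (simp_all add: power2_eq_square)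
  then show ?thesis by (simp add: \<eta>_def)
qed

lemma summable_powr_tail: "s > 1 \<Longrightarrow> summable (\<lambda>j. real (j + n) powr (- s))"
  using summable_ignore_initial_segment[of "\<lambda>j. real j powr (- s)" n] summable_real_powr_iff[of "- s"]
  by simp

lemma summable_coefficients: "summable (\<lambda>j. \<bar>real (j + n) powr (- r)\<bar>)"
  using summable_powr_tail[of r] r3 by simp

lemmas summable_geometric = summable_geometric_coefficients[OF less_imp_le[OF q(1)] q(2)]

lemma continuous: "continuous_on S K" "continuous_on S P"
  unfolding K_def P_def
  by (rule continuous_trig_kernel[OF summable_coefficients] continuous_trig_kernel[OF summable_geometric(1)])+

lemma K_periodic: "K (t + 2 * pi) = K t" unfolding K_def by (rule trig_kernel_periodic)

text \<open>Taking n^(-r) out of (j + n)^(-r) leaves (1 + j/n)^(-r), and the sum of the coefficient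
  differences bounds the kernels uniformly in t.\<close>

lemma K_approx: "\<bar>K t - \<nu> * P t\<bar> \<le> \<nu> * (coefficient_const * \<eta>)"
proof -
  let ?c = "\<lambda>j. (1 + real j / real n) powr (- r)"
  have c: "real (j + n) powr (- r) = \<nu> * ?c j" for j
  proof -
    have "real (j + n) = real n * (1 + real j / real n)" using n2 by (simp add: field_simps)
    then have "real (j + n) powr (- r) = (real n * (1 + real j / real n)) powr (- r)" by (simp only:)
    also have "\<dots> = \<nu> * ?c j" unfolding \<nu>_def by (intro powr_mult) 
    finally show ?thesis .
  qed
  have s: "summable (\<lambda>j. \<bar>?c j\<bar>)"
    using summable_mult[OF summable_coefficients, of "1 / \<nu>"] \<nu>_pos unfolding c by (simp add: abs_mult)
  have K: "K t = \<nu> * trig_kernel ?c n b t"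
    unfolding K_def c by (rule trig_kernel_cmult[OF s])
  have "\<bar>trig_kernel ?c n b t - P t\<bar> \<le> (\<Sum>j. \<bar>?c j - q ^ j\<bar>)"
    unfolding P_def by (rule trig_kernel_diff_le[OF s summable_geometric(1)])
  also have "\<dots> \<le> coefficient_const * \<eta>"
    unfolding q_def \<eta>_def by (rule coefficient_sum_bound[OF rn n2])
  finally have "\<nu> * \<bar>trig_kernel ?c n b t - P t\<bar> \<le> \<nu> * (coefficient_const * \<eta>)"
    using \<nu>_pos by (intro mult_left_mono) auto
  then show ?thesis
    unfolding K using \<nu>_pos by (simp add: abs_mult right_diff_distrib[symmetric])
qed

lemma P_shift: "\<bar>P (t - s) - trig_kernel (\<lambda>j. q ^ j) n (b + real n * s) t\<bar> \<le> 4 * q * \<bar>s\<bar>"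
proof -
  have "\<bar>s\<bar> * (\<Sum>j. real j * \<bar>q ^ j\<bar>) \<le> \<bar>s\<bar> * (4 * q)"
    by (intro mult_left_mono summable_geometric) auto
  then show ?thesis
    using trig_kernel_shift[OF summable_geometric(1,2), of n b t s] by (simp add: P_def mult_ac)
qed

text \<open>A shift by half a period of the leading harmonic changes the sign of the kernel, up to a
  small error. So the mean-zero condition on the test functions costs nothing at leading order.\<close>

lemma K_half_difference:
  "\<bar>(K x - K (x - pi / real n)) / 2 - \<nu> * P x\<bar> \<le> \<nu> * ((coefficient_const + 2 * pi) * \<eta>)"
proof -
  let ?h = "pi / real n"
  have nh: "b + real n * ?h = b + pi" using n2 by simp
  have neg: "trig_kernel (\<lambda>j. q ^ j) n (b + pi) x = - P x"
  proof -
    have "cos (y - (b + pi)) = - cos (y - b)" for y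
      using cos_periodic_pi[of "y - b - pi"] by (simp add: algebra_simps)
    then show ?thesis
      using suminf_minus[OF summable_trig_kernel[OF summable_geometric(1)]]
      unfolding P_def trig_kernel_def by simp
  qed
  have "\<bar>P (x - ?h) + P x\<bar> \<le> 4 * q * ?h"
    using P_shift[of x ?h] unfolding nh neg by simp
  also have "\<dots> = 4 * pi * (q / real n)" by simp
  also have "\<dots> \<le> 4 * pi * \<eta>" using q_div_n_le by (intro mult_left_mono) auto
  finally have "\<bar>\<nu> * P (x - ?h) + \<nu> * P x\<bar> \<le> \<nu> * (4 * pi * \<eta>)"
    using \<nu>_pos by (simp add: abs_mult distrib_left[symmetric])
  moreover have "\<nu> * ((coefficient_const + 2 * pi) * \<eta>) = \<nu> * (coefficient_const * \<eta>) + \<nu> * (4 * pi * \<eta>) / 2"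
    by (simp add: algebra_simps)
  ultimately show ?thesis
    using K_approx[of x] K_approx[of "x - ?h"] unfolding diff_divide_distrib by linarith
qed

lemma test_function:
  obtains \<phi> where "\<phi> \<in> B01"
    and "\<And>x. \<bar>1 / pi * (\<integral>u. \<phi> u * K (x - u) \<partial>period_measure) - \<nu> / pi * P x\<bar>
           \<le> \<nu> / pi * ((coefficient_const + 2 * pi + 1) * \<eta>)"
proof -
  define L where "L = (\<Sum>j. real (j + n) * \<bar>real (j + n) powr (- r)\<bar>)"
  have "real (j + n) * \<bar>real (j + n) powr (- r)\<bar> = real (j + n) powr (- (r - 1))" for j
    using n2 by (simp add: powr_diff powr_minus field_simps)
  then have s: "summable (\<lambda>j. real (j + n) * \<bar>real (j + n) powr (- r)\<bar>)"
    using summable_powr_tail[of "r - 1"] r3 by simp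
  have L0: "0 \<le> L" unfolding L_def by (intro suminf_nonneg s) auto
  have lip: "\<bar>K (t - u) - K t\<bar> \<le> \<bar>u\<bar> * L" for t u
    unfolding K_def L_def by (rule trig_kernel_lipschitz[OF summable_coefficients s])
  \<comment> \<open>The width is so small that the oscillation of the tail over a window is at most
    \<open>\<nu> * \<eta>\<close>; this is the summand 1 in the final constant. The Lipschitz
    constant \<open>L\<close> is finite because r - 1 > 1, and \<open>L + 1\<close> guards the
    division.\<close>
  define e where "e = min pi (\<nu> * \<eta> / (L + 1))"
  have e: "0 < e" "e \<le> pi" using \<nu>_pos \<eta>_pos L0 by (auto simp: e_def)
  have "e * L \<le> \<nu> * \<eta> / (L + 1) * (L + 1)"
    using L0 \<nu>_pos \<eta>_pos by (intro mult_mono) (auto simp: e_def)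
  then have eL: "e * L \<le> \<nu> * \<eta>" using L0 by simp
  have "\<bar>K (t - u) - K t\<bar> \<le> \<nu> * \<eta>" if "\<bar>u\<bar> \<le> e" for t u
    using lip[of t u] mult_right_mono[OF that L0] eL by linarith
  from B01_two_point_test_function[OF e continuous(1) K_periodic this]
  obtain \<phi> where \<phi>: "\<phi> \<in> B01" and A: "\<And>x. \<bar>(\<integral>u. \<phi> u * K (x - u) \<partial>period_measure) -
      (K x - K (x - pi / real n)) / 2\<bar> \<le> \<nu> * \<eta>"
    by blast
  have "\<bar>1 / pi * (\<integral>u. \<phi> u * K (x - u) \<partial>period_measure) - \<nu> / pi * P x\<bar>
           \<le> \<nu> / pi * ((coefficient_const + 2 * pi + 1) * \<eta>)" for x
  proof -
    have "\<bar>(\<integral>u. \<phi> u * K (x - u) \<partial>period_measure) - \<nu> * P x\<bar> \<le> \<nu> * ((coefficient_const + 2 * pi + 1) * \<eta>)"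
    proof -
      have "\<nu> * ((coefficient_const + 2 * pi + 1) * \<eta>) = \<nu> * ((coefficient_const + 2 * pi) * \<eta>) + \<nu> * \<eta>"
        by (simp add: algebra_simps)
      then show ?thesis using A[of x] K_half_difference[of x] by linarith
    qed
    from divide_right_mono[OF this, of pi]
    have "\<bar>((\<integral>u. \<phi> u * K (x - u) \<partial>period_measure) - \<nu> * P x) / pi\<bar> \<le> \<nu> * ((coefficient_const + 2 * pi + 1) * \<eta>) / pi"
      by simp
    then show ?thesis by (simp only: diff_divide_distrib times_divide_eq_left mult_1)
  qed
  then show ?thesis using that \<phi> by blast
qed

lemma K_bounded: "\<bar>K t\<bar> \<le> \<nu> * (1 / (1 - q) + coefficient_const * \<eta>)"
proof -
  have "norm (P t) \<le> (\<Sum>j. \<bar>q ^ j\<bar>)"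
    unfolding P_def trig_kernel_def
    by (rule norm_suminf_le[OF _ summable_geometric(1)]) (simp only: real_norm_def trig_kernel_term_le)
  also have "\<dots> = 1 / (1 - q)" using q suminf_geometric[of q] by simp
  finally have "\<nu> * \<bar>P t\<bar> \<le> \<nu> * (1 / (1 - q))"
    using \<nu>_pos by (intro mult_left_mono) auto
  then have "\<bar>\<nu> * P t\<bar> \<le> \<nu> * (1 / (1 - q))" using \<nu>_pos by (simp add: abs_mult)
  then show ?thesis using K_approx[of t] by (simp add: distrib_left)
qed

definition R :: "(real \<Rightarrow> real) \<Rightarrow> real \<Rightarrow> real" where
  "R \<phi> x = 1 / pi * (\<integral>u. \<phi> u * K (x - u) \<partial>period_measure)"

lemma continuous_R: "\<phi> \<in> B01 \<Longrightarrow> continuous_on S (R \<phi>)"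
  unfolding R_def[abs_def]
  by (intro continuous_intros continuous_convolution[OF B01D(2) continuous(1) K_bounded])

lemma error_Lp:
  assumes p: "p \<ge> 1"
  defines "m \<equiv> lp p cos * gauss_hypergeo (p / 2) (p / 2) 1 (q\<^sup>2) powr (1 / p)"
  shows "(SUP \<phi>\<in>B01. Lp_norm (ereal p) (R \<phi>)) \<le> ereal (\<nu> * (m / pi + main_const * \<eta>))"
    and "ereal (\<nu> * (m / pi - main_const * \<eta>)) \<le> (SUP \<phi>\<in>B01. Lp_norm (ereal p) (R \<phi>))"
proof -
  have "8 * pi\<^sup>2 * q / real n = 8 * pi\<^sup>2 * (q / real n)" by simp
  also have "\<dots> \<le> 8 * pi\<^sup>2 * \<eta>" by (intro mult_left_mono q_div_n_le) auto
  finally have lpP: "\<bar>lp p P - m\<bar> \<le> 8 * pi\<^sup>2 * \<eta>"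
    using lp_geometric_kernel[of q n p b] q p n2 unfolding P_def m_def by fastforce
  have cP: "continuous_on S (\<lambda>t. c * P t)" for S c by (intro continuous_intros continuous)
  have pi2: "8 * pi\<^sup>2 * \<eta> / pi = 8 * pi * \<eta>" by (simp add: power2_eq_square)
  have \<eta>\<nu>: "0 \<le> coefficient_const * \<eta>" "0 \<le> \<eta>" "0 \<le> pi * \<eta>" using \<eta>_pos coefficient_const_nonneg by auto
  show "(SUP \<phi>\<in>B01. Lp_norm (ereal p) (R \<phi>)) \<le> ereal (\<nu> * (m / pi + main_const * \<eta>))"
  proof (rule SUP_least)
    fix \<phi> assume \<phi>: "\<phi> \<in> B01"
    have "lp p (R \<phi>) \<le> 1 / pi * lp p K"
      unfolding R_def[abs_def]
      using lp_convolution_le[OF B01D(2,3)[OF \<phi>] continuous(1) K_bounded K_periodic p]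
      by (subst lp_cmult) (auto simp: p intro: divide_right_mono)
    also have "lp p K \<le> \<nu> * lp p P + 2 * pi * (\<nu> * (coefficient_const * \<eta>))"
      using lp_perturb[OF continuous(1) cP p K_approx] \<nu>_pos p by (simp add: lp_cmult)
    also have "lp p P \<le> m + 8 * pi\<^sup>2 * \<eta>" using lpP by linarith
    finally have "lp p (R \<phi>) \<le> 1 / pi * (\<nu> * (m + 8 * pi\<^sup>2 * \<eta>) + 2 * pi * (\<nu> * (coefficient_const * \<eta>)))"
      using \<nu>_pos by (simp add: divide_right_mono)
    also have "\<dots> = \<nu> * (m / pi + (8 * pi * \<eta> + 2 * (coefficient_const * \<eta>)))"
      by (simp add: field_simps power2_eq_square)
    also have "\<dots> \<le> \<nu> * (m / pi + main_const * \<eta>)"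
      using \<nu>_pos \<eta>\<nu> by (intro mult_left_mono add_left_mono) (auto simp: main_const_def algebra_simps)
    finally show "Lp_norm (ereal p) (R \<phi>) \<le> ereal (\<nu> * (m / pi + main_const * \<eta>))"
      by (simp add: Lp_norm_eq_lp[OF continuous_R[OF \<phi>] p])
  qed
  obtain \<phi> where \<phi>: "\<phi> \<in> B01"
    and A: "\<And>x. \<bar>R \<phi> x - \<nu> / pi * P x\<bar> \<le> \<nu> / pi * ((coefficient_const + 2 * pi + 1) * \<eta>)"
    using test_function unfolding R_def by blast
  have "\<nu> * (m / pi - main_const * \<eta>) \<le>
      \<nu> / pi * (m - 8 * pi\<^sup>2 * \<eta>) - 2 * pi * (\<nu> / pi * ((coefficient_const + 2 * pi + 1) * \<eta>))"
    by (simp add: main_const_def field_simps power2_eq_square)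
  also have "\<dots> \<le> \<nu> / pi * lp p P - 2 * pi * (\<nu> / pi * ((coefficient_const + 2 * pi + 1) * \<eta>))"
    using lpP \<nu>_pos by (intro diff_right_mono mult_left_mono) auto
  also have "\<nu> / pi * lp p P = lp p (\<lambda>x. \<nu> / pi * P x)"
    using \<nu>_pos p by (subst lp_cmult) auto
  also have "lp p (\<lambda>x. \<nu> / pi * P x) - 2 * pi * (\<nu> / pi * ((coefficient_const + 2 * pi + 1) * \<eta>)) \<le> lp p (R \<phi>)"
    using lp_perturb[OF cP continuous_R[OF \<phi>] p, of "\<nu> / pi" "\<nu> / pi * ((coefficient_const + 2 * pi + 1) * \<eta>)"] A
    by (simp add: abs_minus_commute)
  finally show "ereal (\<nu> * (m / pi - main_const * \<eta>)) \<le> (SUP \<phi>\<in>B01. Lp_norm (ereal p) (R \<phi>))"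
    by (intro SUP_upper2[OF \<phi>]) (simp add: Lp_norm_eq_lp[OF continuous_R[OF \<phi>] p])
qed

text \<open>At x with n x congruent to b modulo 2 pi, moving x to the origin changes the phase to a
  multiple of 2 pi. All cosines are then 1 and the series sums to 1/(1 - q), up to the translation
  error 4 q |x|.\<close>

lemma P_peak: "\<exists>x. - pi < x \<and> x < pi \<and> 1 / (1 - q) - 4 * pi * \<eta> \<le> P x"
proof -
  \<comment> \<open>Rounding gives |n x| \<le> pi; with n \<ge> 2 the point is at most pi/2 in
    modulus, hence inside the open period, where the essential supremum dominates the value.\<close>
  define m where "m = round (- b / (2 * pi))"
  define x where "x = (b + 2 * pi * of_int m) / real n"
  have nx: "real n * x = b + 2 * pi * of_int m" using n2 by (simp add: x_def)
  have "\<bar>of_int m - (- b / (2 * pi))\<bar> \<le> 1 / 2" unfolding m_def by (rule of_int_round_abs_le)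
  then have "2 * pi * \<bar>of_int m - (- b / (2 * pi))\<bar> \<le> 2 * pi * (1 / 2)" by (intro mult_left_mono) auto
  also have "2 * pi * (1 / 2) = pi" by simp
  finally have "2 * pi * \<bar>of_int m - (- b / (2 * pi))\<bar> \<le> pi" .
  moreover have "2 * pi * \<bar>of_int m - (- b / (2 * pi))\<bar> = \<bar>real n * x\<bar>"
  proof -
    have "2 * pi * \<bar>of_int m - (- b / (2 * pi))\<bar> = \<bar>2 * pi * (of_int m - (- b / (2 * pi)))\<bar>"
      by (simp add: abs_mult)
    also have "2 * pi * (of_int m - (- b / (2 * pi))) = real n * x"
      unfolding nx by (simp add: field_simps)
    finally show ?thesis .
  qed
  ultimately have "\<bar>real n * x\<bar> \<le> pi" by (simp only:)
  then have nxp: "real n * \<bar>x\<bar> \<le> pi" by (simp add: abs_mult)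
  have "2 * \<bar>x\<bar> \<le> real n * \<bar>x\<bar>" using n2 by (intro mult_right_mono) auto
  with nxp have x: "- pi < x" "x < pi" using pi_gt_zero by linarith+
  have "trig_kernel (\<lambda>j. q ^ j) n (b + real n * (- x)) 0 = 1 / (1 - q)"
  proof -
    have "cos (0 - (b + real n * (- x))) = 1"
      using periodic_plus_int[of cos 0 m] by (simp add: nx)
    then show ?thesis using q suminf_geometric[of q] by (simp add: trig_kernel_def)
  qed
  then have "\<bar>P x - 1 / (1 - q)\<bar> \<le> 4 * q * \<bar>x\<bar>" using P_shift[of 0 "- x"] by simp
  also have "\<dots> \<le> 4 * q * (pi / real n)"
    using nxp n2 q by (intro mult_left_mono) (auto simp: field_simps)
  also have "\<dots> = 4 * pi * (q / real n)" by simp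
  also have "\<dots> \<le> 4 * pi * \<eta>" by (intro mult_left_mono q_div_n_le) auto
  finally show ?thesis using x by (intro exI[of _ x]) (simp add: abs_le_iff)
qed

text \<open>Above, the integral is bounded by the norm of \<open>\<phi>\<close> times the supremum
  of the tail, for which \<open>K_bounded\<close> sums the q^j. Below, the test function is
  evaluated at the single point from \<open>P_peak\<close>.\<close>

lemma error_L_infinity:
  shows "(SUP \<phi>\<in>B01. Lp_norm \<infinity> (R \<phi>)) \<le> ereal (\<nu> * (1 / (pi * (1 - q)) + main_const * \<eta>))"
    and "ereal (\<nu> * (1 / (pi * (1 - q)) - main_const * \<eta>)) \<le> (SUP \<phi>\<in>B01. Lp_norm \<infinity> (R \<phi>))"
proof -
  have \<eta>0: "0 \<le> coefficient_const * \<eta>" "0 \<le> \<eta>" "0 \<le> pi * \<eta>"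
    using \<eta>_pos coefficient_const_nonneg by auto
  have div_pi: "y / pi \<le> y" if "y \<ge> 0" for y
    using divide_left_mono[of 1 pi y] that pi_gt3 by simp
  show "(SUP \<phi>\<in>B01. Lp_norm \<infinity> (R \<phi>)) \<le> ereal (\<nu> * (1 / (pi * (1 - q)) + main_const * \<eta>))"
  proof (rule SUP_least)
    fix \<phi> assume \<phi>: "\<phi> \<in> B01"
    define C where "C = \<nu> * (1 / (1 - q) + coefficient_const * \<eta>)"
    have C0: "0 \<le> C" using K_bounded[of 0] unfolding C_def by linarith
    have "\<bar>R \<phi> x\<bar> \<le> C / pi" for x
    proof -
      have mK: "(\<lambda>u. K (x - u)) \<in> borel_measurable period_measure"
        by (intro period_measurable_continuous continuous_on_compose2[OF continuous(1)[of UNIV]] continuous_intros) auto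
      have "\<bar>\<integral>u. \<phi> u * K (x - u) \<partial>period_measure\<bar> \<le> (\<integral>u. \<bar>\<phi> u\<bar> * C \<partial>period_measure)"
      proof (rule integral_abs_bound_integral)
        show "integrable period_measure (\<lambda>u. \<bar>\<phi> u\<bar> * C)" using B01D(2)[OF \<phi>] by simp
        show b: "\<bar>\<phi> u * K (x - u)\<bar> \<le> \<bar>\<phi> u\<bar> * C" for u
          using K_bounded by (simp add: abs_mult C_def mult_left_mono)
        show "integrable period_measure (\<lambda>u. \<phi> u * K (x - u))"
        proof (rule Bochner_Integration.integrable_bound)
          show "integrable period_measure (\<lambda>u. \<bar>\<phi> u\<bar> * C)" using B01D(2)[OF \<phi>] by simp
          show "AE u in period_measure. norm (\<phi> u * K (x - u)) \<le> norm (\<bar>\<phi> u\<bar> * C)"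
            using b by (intro AE_I2) (simp add: order.trans[OF _ abs_ge_self])
        qed (intro borel_measurable_times mK borel_measurable_integrable B01D(2)[OF \<phi>])
      qed
      also have "\<dots> = (\<integral>u. \<bar>\<phi> u\<bar> \<partial>period_measure) * C" by simp
      also have "\<dots> \<le> 1 * C" using B01D(3)[OF \<phi>] C0 by (intro mult_right_mono)
      finally show ?thesis by (simp add: R_def divide_right_mono)
    qed
    then have "Lp_norm \<infinity> (R \<phi>) \<le> ereal (C / pi)"
      by (rule Lp_norm_infinity_le[OF continuous_R[OF \<phi>]])
    also have "C / pi \<le> \<nu> * (1 / (pi * (1 - q)) + main_const * \<eta>)"
    proof -
      have "C / pi = \<nu> * (1 / (pi * (1 - q)) + coefficient_const * \<eta> / pi)"
        using q by (simp add: C_def field_simps)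
      also have "\<dots> \<le> \<nu> * (1 / (pi * (1 - q)) + main_const * \<eta>)"
      proof (intro mult_left_mono add_left_mono)
        have "main_const * \<eta> = 2 * (coefficient_const * \<eta>) + 12 * (pi * \<eta>) + 2 * \<eta>"
          by (simp add: main_const_def distrib_right)
        then show "coefficient_const * \<eta> / pi \<le> main_const * \<eta>"
          using div_pi[OF \<eta>0(1)] \<eta>0 by linarith
      qed (use \<nu>_pos in simp)
      finally show ?thesis .
    qed
    finally show "Lp_norm \<infinity> (R \<phi>) \<le> ereal (\<nu> * (1 / (pi * (1 - q)) + main_const * \<eta>))" by simp
  qed
  obtain \<phi> where \<phi>: "\<phi> \<in> B01"
    and A: "\<And>x. \<bar>R \<phi> x - \<nu> / pi * P x\<bar> \<le> \<nu> / pi * ((coefficient_const + 2 * pi + 1) * \<eta>)"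
    using test_function unfolding R_def by blast
  obtain x where x: "- pi < x" "x < pi" and Px: "1 / (1 - q) - 4 * pi * \<eta> \<le> P x"
    using P_peak by blast
  let ?d = "(coefficient_const + 2 * pi + 1) * \<eta> + 4 * pi * \<eta>"
  have "?d / pi \<le> ?d" using \<eta>0 by (intro div_pi) (simp add: distrib_right)
  also have "?d \<le> main_const * \<eta>" using \<eta>0 by (simp add: main_const_def distrib_right)
  finally have "\<nu> * (1 / (pi * (1 - q)) - main_const * \<eta>) \<le> \<nu> * (1 / (pi * (1 - q)) - ?d / pi)"
    using \<nu>_pos by (intro mult_left_mono) auto
  also have "\<dots> = \<nu> / pi * (1 / (1 - q) - 4 * pi * \<eta>) - \<nu> / pi * ((coefficient_const + 2 * pi + 1) * \<eta>)"
    using q by (simp add: field_simps)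
  also have "\<dots> \<le> \<nu> / pi * P x - \<nu> / pi * ((coefficient_const + 2 * pi + 1) * \<eta>)"
    using Px \<nu>_pos by (intro diff_right_mono mult_left_mono) auto
  also have "\<dots> \<le> \<bar>R \<phi> x\<bar>" using A[of x] by linarith
  finally have "ereal (\<nu> * (1 / (pi * (1 - q)) - main_const * \<eta>)) \<le> ereal \<bar>R \<phi> x\<bar>" by simp
  also have "\<dots> \<le> Lp_norm \<infinity> (R \<phi>)" by (rule Lp_norm_infinity_ge[OF continuous_R[OF \<phi>] x])
  finally show "ereal (\<nu> * (1 / (pi * (1 - q)) - main_const * \<eta>)) \<le> (SUP \<phi>\<in>B01. Lp_norm \<infinity> (R \<phi>))"
    by (rule SUP_upper2[OF \<phi>])
qed

end

section \<open>From two-sided bounds to a remainder with bounded factor\<close>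

text \<open>Two real bounds make the supremum finite, and since \<open>\<nu>\<close> and
  \<open>\<eta>\<close> are positive the equation can be solved for the factor \<theta>.\<close>

lemma ereal_squeeze_remainder:
  fixes \<nu> \<eta> m C :: real and E :: ereal
  assumes "\<nu> > 0" "\<eta> > 0" and "E \<le> ereal (\<nu> * (m + C * \<eta>))" "ereal (\<nu> * (m - C * \<eta>)) \<le> E"
  obtains \<theta> where "\<bar>\<theta>\<bar> \<le> C" and "E = ereal (\<nu> * (m + \<theta> * \<eta>))"
proof -
  obtain x where x: "E = ereal x" using assms(3,4) by (cases E) auto
  define \<theta> where "\<theta> = (x / \<nu> - m) / \<eta>"
  have e: "x = \<nu> * (m + \<theta> * \<eta>)" using assms(1,2) by (simp add: \<theta>_def)
  have "\<theta> * \<eta> \<le> C * \<eta>" "(- C) * \<eta> \<le> \<theta> * \<eta>"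
    using assms unfolding x e by simp_all
  then have "\<bar>\<theta>\<bar> \<le> C" using assms(2) unfolding mult_le_cancel_right_pos[OF assms(2)] by linarith
  then show ?thesis using that x e by blast
qed

theorem theorem4:
  shows "\<exists>C::real. \<forall>(\<beta>::real) (r::real) (n::nat).
    n \<ge> 1 \<and> r > 1 \<and> real n + 1 \<le> r \<and> r \<le> (real n)\<^sup>2 \<longrightarrow>
      (\<forall>p::real. p \<ge> 1 \<longrightarrow>
        (\<exists>\<theta>::real. \<bar>\<theta>\<bar> \<le> C \<and>
          fourier_approx_error n (weyl_nagy_class r \<beta>) (ereal p) =
            ereal (real n powr (- r)) *
              (Lp_norm (ereal p) cos / ereal pi
                 * ereal (gauss_hypergeo (p / 2) (p / 2) 1 (exp (- 2 * r / real n)) powr (1 / p))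
               + ereal (\<theta> * (r / (real n)\<^sup>2 * exp (- r / real n)))))) \<and>
      (\<exists>\<theta>::real. \<bar>\<theta>\<bar> \<le> C \<and>
          fourier_approx_error n (weyl_nagy_class r \<beta>) \<infinity> =
            ereal (real n powr (- r) *
              (1 / (pi * (1 - exp (- r / real n)))
               + \<theta> * (r / (real n)\<^sup>2 * exp (- r / real n)))))"
proof (rule exI[of _ main_const], intro allI impI conjI)
  fix \<beta> r :: real and n :: nat and p :: real
  assume A: "n \<ge> 1 \<and> r > 1 \<and> real n + 1 \<le> r \<and> r \<le> (real n)\<^sup>2" and p: "p \<ge> 1"
  \<comment> \<open>For n = 1 the hypotheses would say 2 \<le> r \<le> 1; this supplies the n \<ge>
    2 of the locale.\<close>
  have "n \<noteq> 1" using A by auto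
  then interpret weyl_nagy_tail n r "\<beta> * pi / 2" using A by unfold_locales auto
  obtain \<theta> where "\<bar>\<theta>\<bar> \<le> main_const" and "(SUP \<phi>\<in>B01. Lp_norm (ereal p) (R \<phi>)) =
      ereal (\<nu> * (lp p cos * gauss_hypergeo (p / 2) (p / 2) 1 (q\<^sup>2) powr (1 / p) / pi + \<theta> * \<eta>))"
    by (rule ereal_squeeze_remainder[OF \<nu>_pos \<eta>_pos error_Lp[OF p]])
  moreover have "exp (- 2 * r / real n) = q\<^sup>2"
    by (simp add: q_def power2_eq_square flip: exp_add)
  moreover have "fourier_approx_error n (weyl_nagy_class r \<beta>) (ereal p) = (SUP \<phi>\<in>B01. Lp_norm (ereal p) (R \<phi>))"
    using fourier_approx_error_weyl_nagy[of r n \<beta> "ereal p"] A by (simp only: R_def[abs_def] K_def)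
  moreover have "Lp_norm (ereal p) cos = ereal (lp p cos)"
    by (intro Lp_norm_eq_lp p continuous_intros)
  ultimately show "\<exists>\<theta>::real. \<bar>\<theta>\<bar> \<le> main_const \<and>
          fourier_approx_error n (weyl_nagy_class r \<beta>) (ereal p) =
            ereal (real n powr (- r)) *
              (Lp_norm (ereal p) cos / ereal pi
                 * ereal (gauss_hypergeo (p / 2) (p / 2) 1 (exp (- 2 * r / real n)) powr (1 / p))
               + ereal (\<theta> * (r / (real n)\<^sup>2 * exp (- r / real n))))"
    unfolding \<nu>_def \<eta>_def q_def[symmetric] by (intro exI[of _ \<theta>]) simp
next
  fix \<beta> r :: real and n :: nat
  assume A: "n \<ge> 1 \<and> r > 1 \<and> real n + 1 \<le> r \<and> r \<le> (real n)\<^sup>2"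
  have "n \<noteq> 1" using A by auto
  then interpret weyl_nagy_tail n r "\<beta> * pi / 2" using A by unfold_locales auto
  obtain \<theta> where "\<bar>\<theta>\<bar> \<le> main_const" and "(SUP \<phi>\<in>B01. Lp_norm \<infinity> (R \<phi>)) =
      ereal (\<nu> * (1 / (pi * (1 - q)) + \<theta> * \<eta>))"
    by (rule ereal_squeeze_remainder[OF \<nu>_pos \<eta>_pos error_L_infinity])
  moreover have "fourier_approx_error n (weyl_nagy_class r \<beta>) \<infinity> = (SUP \<phi>\<in>B01. Lp_norm \<infinity> (R \<phi>))"
    using fourier_approx_error_weyl_nagy[of r n \<beta> \<infinity>] A by (simp only: R_def[abs_def] K_def)
  ultimately show "\<exists>\<theta>::real. \<bar>\<theta>\<bar> \<le> main_const \<and>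
          fourier_approx_error n (weyl_nagy_class r \<beta>) \<infinity> =
            ereal (real n powr (- r) *
              (1 / (pi * (1 - exp (- r / real n)))
               + \<theta> * (r / (real n)\<^sup>2 * exp (- r / real n))))"
    unfolding \<nu>_def \<eta>_def q_def by (intro exI[of _ \<theta>]) simp
qed

end
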